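(* Let $t\in(0,T]$. The bilinear form $\mathscr{B}_t^*$ satisfies \[ \sup_{0\neq y\in\mathcal{Y}^t\times H}\ \sup_{0\neq x\in\mathcal{X}^t}\frac{\mathscr{B}_t^*(y,x)}{|y|_{\mathcal{Y}^t_H}\,|x|_{\mathcal{X}^t}}=1 \quad\text{and}\quad \inf_{0\neq y\in\mathcal{Y}^t\times H}\ \sup_{0\neq x\in\mathcal{X}^t}\frac{\mathscr{B}_t^*(y,x)}{|y|_{\mathcal{Y}^t_H}\,|x|_{\mathcal{X}^t}}=1 . \]
   Context: Let $V\hookrightarrow H\hookrightarrow V^*$ be a Gelfand triple of real separable Hilbert spaces, with $V$ densely embedded in $H$. Write $(\cdot,\cdot)$ for the inner product of $H$ and $\langle\cdot,\cdot\rangle$ for the $V^*$–$V$ duality, which extends $(\cdot,\cdot)$. Let $a:V\times V\to\mathbb{R}$ be a symmetric bilinear form with $|a(u,v)|\le A_{\max}\|u\|_V\|v\|_V$ and $a(v,v)\ge A_{\min}\|v\|_V^2$ for some constants $A_{\max},A_{\min}>0$. Let $A:V\to V^*$ be defined by $\langle Au,v\rangle=a(u,v)$, with fractional powers defined in the usual way, so that $\|A^{1/2}v\|_H^2=a(v,v)$. For $0<t\le T$ define: - $\mathcal{Y}^t=L^2((0,t);V)$; - $\mathcal{X}^t=L^2((0,t);V)\cap H^1((0,t);V^* )$, whose elements are continuous $[0,t]\to H$; - the norm on $\mathcal{Y}^t\times H$ given by $|y|_{\mathcal{Y}^t_H}^2=\|y_2\|_H^2+\int_0^t\|A^{1/2}y_1(s)\|_H^2\,\mathrm{d}s$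 for $y=(y_1,y_2)$; - the norm on $\mathcal{X}^t$ given by $|x|_{\mathcal{X}^t}^2=\|x(0)\|_H^2+\int_0^t\big(\|A^{1/2}x\|_H^2+\|A^{-1/2}\dot x\|_H^2\big)\,\mathrm{d}s$; - the bilinear form $\mathscr{B}_t^*(y,x)=\int_0^t\langle y_1(s),-\dot x(s)+Ax(s)\rangle\,\mathrm{d}s+(y_2,x(t))$ for $y=(y_1,y_2)\in\mathcal{Y}^t\times H$ and $x\in\mathcal{X}^t$. *)

theory Defs
  imports "HOL-Analysis.Analysis"
begin

definition sq_int_on :: "real \<Rightarrow> (real \<Rightarrow> 'a::real_normed_vector) \<Rightarrow> bool" where
  "sq_int_on t f \<longleftrightarrow> set_borel_measurable lborel {0<..<t} f \<and>
     set_integrable lborel {0<..<t} (\<lambda>s. (norm (f s))\<^sup>2)"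

definition test_fun :: "real \<Rightarrow> (real \<Rightarrow> real) \<Rightarrow> bool" where
  "test_fun t \<phi> \<longleftrightarrow> (\<forall>k s. ((deriv ^^ k) \<phi>) differentiable (at s)) \<and>
     closure {s. \<phi> s \<noteq> 0} \<subseteq> {0<..<t}"

text \<open>g : (0,t) -> V* is the weak (distributional) derivative of the H-valued function xh,
  where H is embedded in V* via h |-> (v |-> (h, j v)).  Tested against each v in V.\<close>
definition weak_deriv_dual ::
  "('v \<Rightarrow> 'h::real_inner) \<Rightarrow> real \<Rightarrow> (real \<Rightarrow> 'h) \<Rightarrow> (real \<Rightarrow> ('v::real_normed_vector \<Rightarrow>\<^sub>L real)) \<Rightarrow> bool" where
  "weak_deriv_dual j t xh g \<longleftrightarrow>
     (\<forall>\<phi> v. test_fun t \<phi> \<longrightarrow>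
        (LINT s:{0<..<t}|lborel. deriv \<phi> s * inner (xh s) (j v))
        = - (LINT s:{0<..<t}|lborel. \<phi> s * blinfun_apply (g s) v))"

text \<open>Membership in X^t = L^2(0,t;V) \<inter> H^1(0,t;V*): xv is the V-valued representative,
  xh the continuous H-valued representative on [0,t], g the weak derivative in V*.\<close>
definition in_X ::
  "('v::real_normed_vector \<Rightarrow> 'h::real_inner) \<Rightarrow> real \<Rightarrow> (real \<Rightarrow> 'h) \<Rightarrow> (real \<Rightarrow> 'v)
     \<Rightarrow> (real \<Rightarrow> ('v \<Rightarrow>\<^sub>L real)) \<Rightarrow> bool" where
  "in_X j t xh xv g \<longleftrightarrow> sq_int_on t xv \<and> continuous_on {0..t} xh \<and>
     (AE s in lborel. s \<in> {0<..<t} \<longrightarrow> j (xv s) = xh s) \<and>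
     sq_int_on t g \<and> weak_deriv_dual j t xh g"

text \<open>The norm ||A^{-1/2} f||_H of f in V*, i.e. the dual norm with respect to the energy
  norm v |-> sqrt (a v v) = ||A^{1/2} v||_H.\<close>
definition Ainvhalf_norm :: "('v::real_normed_vector \<Rightarrow> 'v \<Rightarrow> real) \<Rightarrow> ('v \<Rightarrow>\<^sub>L real) \<Rightarrow> real" where
  "Ainvhalf_norm a f = (SUP v\<in>{v. v \<noteq> 0}. \<bar>blinfun_apply f v\<bar> / sqrt (a v v))"

definition normY :: "('v \<Rightarrow> 'v \<Rightarrow> real) \<Rightarrow> real \<Rightarrow> (real \<Rightarrow> 'v) \<Rightarrow> 'h::real_normed_vector \<Rightarrow> real" where
  "normY a t y1 y2 = sqrt ((norm y2)\<^sup>2 + (LINT s:{0<..<t}|lborel. a (y1 s) (y1 s)))"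

definition normX ::
  "('v::real_normed_vector \<Rightarrow> 'v \<Rightarrow> real) \<Rightarrow> real \<Rightarrow> (real \<Rightarrow> 'h::real_normed_vector) \<Rightarrow> (real \<Rightarrow> 'v)
     \<Rightarrow> (real \<Rightarrow> ('v \<Rightarrow>\<^sub>L real)) \<Rightarrow> real" where
  "normX a t xh xv g = sqrt ((norm (xh 0))\<^sup>2 +
      (LINT s:{0<..<t}|lborel. a (xv s) (xv s) + (Ainvhalf_norm a (g s))\<^sup>2))"

definition Bstar ::
  "('v::real_normed_vector \<Rightarrow> 'v \<Rightarrow> real) \<Rightarrow> real \<Rightarrow> (real \<Rightarrow> 'v) \<Rightarrow> 'h::real_inner
     \<Rightarrow> (real \<Rightarrow> 'h) \<Rightarrow> (real \<Rightarrow> 'v) \<Rightarrow> (real \<Rightarrow> ('v \<Rightarrow>\<^sub>L real)) \<Rightarrow> real" where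
  "Bstar a t y1 y2 xh xv g =
     (LINT s:{0<..<t}|lborel. - blinfun_apply (g s) (y1 s) + a (xv s) (y1 s)) + inner y2 (xh t)"

definition Yset :: "real \<Rightarrow> ((real \<Rightarrow> 'v::real_normed_vector) \<times> 'h::real_normed_vector) set" where
  "Yset t = {(y1, y2). sq_int_on t y1 \<and>
      \<not> ((AE s in lborel. s \<in> {0<..<t} \<longrightarrow> y1 s = 0) \<and> y2 = 0)}"

definition Xset :: "('v::real_normed_vector \<Rightarrow> 'h::real_inner) \<Rightarrow> real
     \<Rightarrow> ((real \<Rightarrow> 'h) \<times> (real \<Rightarrow> 'v) \<times> (real \<Rightarrow> ('v \<Rightarrow>\<^sub>L real))) set" where
  "Xset j t = {(xh, xv, g). in_X j t xh xv g \<and> \<not> (AE s in lborel. s \<in> {0<..<t} \<longrightarrow> xv s = 0)}"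

end

(* Writing w = A^-1 x' for the Riesz representer of the weak derivative, the form B*(y, x) is the
   inner product of y with S x = (x - w, x(t)) in Y^t x H. If z is such that the integration by
   parts formula holds between z and every x in X^t, expanding (S x, S z) gives the inner product
   (x, z) of X^t, so S is isometric on such z. Since S maps these z onto a dense subset of Y^t x H,
   both B*(y, x) <= |y| |x| (approximate y by S z) and the reverse bound (take x = z) follow,
   and the supremum over x equals 1 for every single y.

   The z used are piecewise linear in time: for them the integration by parts formula follows from
   the definition of the weak derivative alone, so the general Lions-Magenes formula is not needed.
   Density is obtained by approximately solving the backward problem for step functions y with the
   implicit Euler scheme. *)

theory Submission
  imports Defs
begin

section \<open>Smooth step functions\<close>

text \<open>The weak derivative is given only through smooth functions supported inside (0, t),
  while the argument needs values at single times. Smooth cutoffs approximating the indicator of (0,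
  b) bridge this gap: for each fixed v in V they show that (x(b) - x(0), j v) is the integral of
  <x', v> over (0, b). A piecewise linear z is a finite sum of scalar functions of time times fixed
  vectors of V, so this scalar identity suffices to integrate by parts between z and any x.

  Density has to be shown without spectral theory for A and without regularity of the backward
  solution. For y equal to v on (0, b) and zero afterwards, the defect v - x follows the homogeneous
  equation backwards from the value v. Since v lies in V, its energy a(v, v) is finite, and implicit
  Euler steps never increase it; this bounds the total error by a multiple of the step size.

  A further care is that x counts as nonzero only through its V-valued part, so the near-maximiser z
  must be shown to have a nonzero one.\<close>

inductive lin_span :: "((real \<Rightarrow> real) \<Rightarrow> bool) \<Rightarrow> (real \<Rightarrow> real) \<Rightarrow> bool" for S where
  base: "S f \<Longrightarrow> lin_span S f"
| lin: "lin_span S f \<Longrightarrow> lin_span S g \<Longrightarrow> lin_span S (\<lambda>x. f x + c * g x)"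

definition smooth :: "(real \<Rightarrow> real) \<Rightarrow> bool" where
  "smooth f \<longleftrightarrow> (\<forall>k s. ((deriv ^^ k) f) differentiable (at s))"

text \<open>The linear span of \<open>S\<close> is stable under differentiation, so all iterates of
  \<open>deriv\<close> stay inside it and no formula for higher derivatives is required. Each
  smoothness proof below amounts to finding a suitable \<open>S\<close>.\<close>

lemma smooth_if_deriv_in_span:
  assumes S: "\<And>f. S f \<Longrightarrow> \<exists>f'. lin_span S f' \<and> (\<forall>x. (f has_real_derivative f' x) (at x))"
    and f: "S f"
  shows "smooth f"
proof -
  have deriv_span: "\<exists>h'. lin_span S h' \<and> (\<forall>x. (h has_real_derivative h' x) (at x))"
    if "lin_span S h" for h
    using that
  proof induction
    case (lin f g c)
    then obtain f' g' where f': "lin_span S f'" "\<And>x. (f has_real_derivative f' x) (at x)"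
      and g': "lin_span S g'" "\<And>x. (g has_real_derivative g' x) (at x)"
      by blast
    show ?case
      by (intro exI[of _ "\<lambda>x. f' x + c * g' x"] conjI allI lin_span.lin f' g' DERIV_add DERIV_cmult)
  qed (use S in blast)
  have "lin_span S ((deriv ^^ k) f)" for k
  proof (induction k)
    case (Suc k)
    then obtain h' where "lin_span S h'" "\<And>x. ((deriv ^^ k) f has_real_derivative h' x) (at x)"
      using deriv_span by blast
    moreover from this(2) have "deriv ((deriv ^^ k) f) = h'"
      by (intro ext DERIV_imp_deriv)
    ultimately show ?case by simp
  qed (simp add: f lin_span.base)
  then show ?thesis
    unfolding smooth_def using deriv_span by (meson real_differentiable_def)
qed

lemma smooth_has_deriv: "smooth f \<Longrightarrow> (f has_real_derivative deriv f x) (at x)"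
  unfolding smooth_def by (metis DERIV_imp_deriv funpow_0 real_differentiable_def)

lemma smooth_deriv: "smooth f \<Longrightarrow> smooth (deriv f)"
  unfolding smooth_def by (metis comp_apply funpow_Suc_right)

lemma smooth_continuous: "smooth f \<Longrightarrow> isCont f x"
  using smooth_has_deriv DERIV_isCont by blast

lemma smooth_mult: "smooth f \<Longrightarrow> smooth g \<Longrightarrow> smooth (\<lambda>x. f x * g x)"
proof (rule smooth_if_deriv_in_span[where S="\<lambda>h. \<exists>f g. smooth f \<and> smooth g \<and> h = (\<lambda>x. f x * g x)"])
  fix h assume "\<exists>f g. smooth f \<and> smooth g \<and> h = (\<lambda>x. f x * g x)"
  then obtain f g where fg: "smooth f" "smooth g" and h: "h = (\<lambda>x. f x * g x)" by blast
  let ?S = "\<lambda>h. \<exists>f g. smooth f \<and> smooth g \<and> h = (\<lambda>x. f x * g x)"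
  show "\<exists>h'. lin_span ?S h' \<and> (\<forall>x. (h has_real_derivative h' x) (at x))"
  proof (intro exI conjI allI)
    show "lin_span ?S (\<lambda>x. f x * deriv g x + 1 * (deriv f x * g x))"
      by (intro lin_span.lin lin_span.base) (use fg smooth_deriv in blast)+
    show "(h has_real_derivative f x * deriv g x + 1 * (deriv f x * g x)) (at x)" for x
      unfolding h by (auto intro!: derivative_eq_intros smooth_has_deriv fg)
  qed
qed blast

text \<open>Compositions alone do not have derivatives in their span, because the chain rule
  produces a factor \<open>deriv g\<close>. The extra factor \<open>h\<close> absorbs it.\<close>

lemma smooth_compose_mult:
  "smooth f \<Longrightarrow> smooth g \<Longrightarrow> smooth h \<Longrightarrow> smooth (\<lambda>x. f (g x) * h x)"
proof (rule smooth_if_deriv_in_span[where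
      S="\<lambda>p. \<exists>f g h. smooth f \<and> smooth g \<and> smooth h \<and> p = (\<lambda>x. f (g x) * h x)"])
  let ?S = "\<lambda>p. \<exists>f g h. smooth f \<and> smooth g \<and> smooth h \<and> p = (\<lambda>x. f (g x) * h x)"
  fix p assume "?S p"
  then obtain f g h where fgh: "smooth f" "smooth g" "smooth h"
    and p: "p = (\<lambda>x. f (g x) * h x)" by blast
  show "\<exists>p'. lin_span ?S p' \<and> (\<forall>x. (p has_real_derivative p' x) (at x))"
  proof (intro exI conjI allI)
    show "lin_span ?S (\<lambda>x. deriv f (g x) * (deriv g x * h x) + 1 * (f (g x) * deriv h x))"
    proof (intro lin_span.lin lin_span.base)
      show "?S (\<lambda>x. deriv f (g x) * (deriv g x * h x))"
        using fgh by (intro exI[of _ "deriv f"] exI[of _ g] exI[of _ "\<lambda>x. deriv g x * h x"]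
            conjI refl smooth_mult smooth_deriv)
      show "?S (\<lambda>x. f (g x) * deriv h x)"
        using fgh smooth_deriv by blast
    qed
    show "(p has_real_derivative deriv f (g x) * (deriv g x * h x) + 1 * (f (g x) * deriv h x)) (at x)" for x
      unfolding p by (auto intro!: derivative_eq_intros smooth_has_deriv fgh DERIV_chain2[where f=f])
  qed
qed blast

lemma smooth_affine: "smooth (\<lambda>x. c * x + d)"
proof (rule smooth_if_deriv_in_span[where S="\<lambda>f. \<exists>c d. f = (\<lambda>x. c * x + d)"])
  let ?S = "\<lambda>f :: real \<Rightarrow> real. \<exists>c d. f = (\<lambda>x. c * x + d)"
  fix f assume "?S f"
  then obtain c d where f: "f = (\<lambda>x. c * x + d)" by blast
  show "\<exists>f'. lin_span ?S f' \<and> (\<forall>x. (f has_real_derivative f' x) (at x))"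
  proof (intro exI conjI allI)
    show "lin_span ?S (\<lambda>x. 0 * x + c)"
      by (rule lin_span.base) blast
    show "(f has_real_derivative 0 * x + c) (at x)" for x
      unfolding f by (auto intro!: derivative_eq_intros)
  qed
qed blast

lemma smooth_compose:
  assumes "smooth f" "smooth g" shows "smooth (\<lambda>x. f (g x))"
  using smooth_compose_mult[OF assms smooth_affine[of 0 1]] by simp

lemma smooth_lin:
  assumes "smooth f" "smooth g" shows "smooth (\<lambda>x. f x + c * g x)"
proof (rule smooth_if_deriv_in_span[where S="\<lambda>h. \<exists>f g. smooth f \<and> smooth g \<and> h = (\<lambda>x. f x + c * g x)"])
  let ?S = "\<lambda>h. \<exists>f g. smooth f \<and> smooth g \<and> h = (\<lambda>x. f x + c * g x)"
  fix h assume "?S h"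
  then obtain f g where fg: "smooth f" "smooth g" and h: "h = (\<lambda>x. f x + c * g x)" by blast
  show "\<exists>h'. lin_span ?S h' \<and> (\<forall>x. (h has_real_derivative h' x) (at x))"
  proof (intro exI conjI allI)
    show "lin_span ?S (\<lambda>x. deriv f x + c * deriv g x)"
      by (intro lin_span.base) (use fg smooth_deriv in blast)
    show "(h has_real_derivative deriv f x + c * deriv g x) (at x)" for x
      unfolding h by (intro DERIV_add DERIV_cmult smooth_has_deriv fg)
  qed
qed (use assms in blast)

text \<open>\<open>flat 0\<close> is the classical smooth function exp(-1/x) that vanishes to
  infinite order at 0; the powers of 1/x are included because differentiation creates them.\<close>

definition flat :: "nat \<Rightarrow> real \<Rightarrow> real" where
  "flat n x = (if x > 0 then inverse x ^ n * exp (- inverse x) else 0)"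

lemma flat_has_deriv:
  "(flat n has_real_derivative flat (n + 2) x + - real n * flat (n + 1) x) (at x)"
proof -
  consider "x < 0" | "x = 0" | "x > 0" by linarith
  then show ?thesis
  proof cases
    case 1
    have "((\<lambda>_. 0) has_real_derivative 0) (at x)" by simp
    then have "(flat n has_real_derivative 0) (at x)"
      by (rule DERIV_cong_ev[THEN iffD1, rotated -1])
        (use 1 eventually_nhds_in_open[of "{..<0}" x] in \<open>auto elim!: eventually_mono simp: flat_def\<close>)
    with 1 show ?thesis by (simp add: flat_def)
  next
    case 3
    have "((\<lambda>x. inverse x ^ n * exp (- inverse x)) has_real_derivative
        flat (n + 2) x + - real n * flat (n + 1) x) (at x)"
      using 3
      apply (auto intro!: derivative_eq_intros simp: flat_def)
      apply (cases n)
       apply (auto simp: field_simps power2_eq_square)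
      done
    then show ?thesis
      by (rule DERIV_cong_ev[THEN iffD1, rotated -1])
        (use 3 eventually_nhds_in_open[of "{0<..}" x] in \<open>auto elim!: eventually_mono simp: flat_def\<close>)
  next
    case 2
    \<comment> \<open>The difference quotient at 0 from the right is y^(n+1) exp(-y) with y = 1/h
      tending to infinity.\<close>
    have "((\<lambda>y::real. y ^ (n + 1) / exp y) \<longlongrightarrow> 0) at_top"
      by (rule tendsto_power_div_exp_0)
    then have "((\<lambda>h. inverse h ^ (n + 1) / exp (inverse h)) \<longlongrightarrow> (0::real)) (at_right 0)"
      by (rule filterlim_compose[OF _ filterlim_inverse_at_top_right])
    then have "((\<lambda>h. flat n h / h) \<longlongrightarrow> 0) (at_right 0)"
      by (rule Lim_transform_eventually)
        (auto simp: eventually_at_right_field flat_def exp_minus field_simps intro!: exI[of _ 1])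
    moreover have "((\<lambda>h. flat n h / h) \<longlongrightarrow> 0) (at_left 0)"
      by (rule Lim_transform_eventually[of "\<lambda>_. 0"])
        (auto simp: eventually_at_left_field flat_def intro!: exI[of _ "-1"])
    ultimately have "((\<lambda>h. flat n h / h) \<longlongrightarrow> 0) (at 0)"
      by (simp add: filterlim_at_split)
    with 2 show ?thesis by (simp add: DERIV_def flat_def[of _ 0])
  qed
qed

lemma smooth_flat: "smooth (flat n)"
proof (rule smooth_if_deriv_in_span[where S="\<lambda>f. \<exists>n. f = flat n"])
  let ?S = "\<lambda>f. \<exists>n. f = flat n"
  fix f assume "?S f"
  then obtain n where "f = flat n" by blast
  then show "\<exists>f'. lin_span ?S f' \<and> (\<forall>x. (f has_real_derivative f' x) (at x))"
    using flat_has_deriv[of n]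
    by (intro exI[of _ "\<lambda>x. flat (n + 2) x + - real n * flat (n + 1) x"] conjI allI
        lin_span.lin lin_span.base) blast+
qed blast

text \<open>Nesting \<open>flat 0\<close> keeps the denominator constant, so smoothness follows from
  composition alone. For x \<le> 0 the inner difference is nonpositive and \<open>flat 0\<close>
  annihilates it; for x \<ge> 1 it equals \<open>flat 0 1\<close>.\<close>

definition smooth_step :: "real \<Rightarrow> real" where
  "smooth_step x = flat 0 (flat 0 1 - flat 0 (1 - x)) / flat 0 (flat 0 1)"

lemma flat0_mono: "x \<le> y \<Longrightarrow> flat 0 x \<le> flat 0 y"
  by (auto simp: flat_def intro: le_imp_inverse_le)

lemma flat0_pos: "x > 0 \<Longrightarrow> flat 0 x > 0" and flat0_nonpos: "x \<le> 0 \<Longrightarrow> flat 0 x = 0"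
  by (auto simp: flat_def)

lemma smooth_step_0: "x \<le> 0 \<Longrightarrow> smooth_step x = 0"
  using flat0_mono[of 1 "1 - x"] by (auto simp: smooth_step_def flat0_nonpos)

lemma smooth_step_1: "x \<ge> 1 \<Longrightarrow> smooth_step x = 1"
  using flat0_pos[of "flat 0 1"] flat0_pos[of 1] by (simp add: smooth_step_def flat0_nonpos)

lemma smooth_step_mono: "mono smooth_step"
  unfolding smooth_step_def
  by (intro monoI divide_right_mono flat0_mono diff_left_mono)
    (simp_all add: flat_def)

lemma smooth_step_bounds: "0 \<le> smooth_step x" "smooth_step x \<le> 1"
  using monoD[OF smooth_step_mono, of "min x 0" x] monoD[OF smooth_step_mono, of x "max x 1"]
  by (auto simp: smooth_step_0 smooth_step_1)

lemma smooth_smooth_step: "smooth smooth_step"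
proof -
  have "smooth (\<lambda>x. flat 0 ((-1) * x + 1))"
    by (rule smooth_compose[OF smooth_flat smooth_affine])
  from smooth_compose[OF smooth_affine[of "-1" "flat 0 1"] this]
  have "smooth (\<lambda>x. flat 0 ((-1) * flat 0 ((-1) * x + 1) + flat 0 1))"
    by (rule smooth_compose[OF smooth_flat])
  from smooth_compose[OF smooth_affine[of "inverse (flat 0 (flat 0 1))" 0] this]
  show ?thesis
    by (rule back_subst[where P=smooth]) (simp add: smooth_step_def fun_eq_iff divide_inverse_commute)
qed

section \<open>Integrating a weak derivative\<close>

abbreviation Iv :: "real \<Rightarrow> real measure" where
  "Iv t \<equiv> restrict_space lborel {0<..<t}"

lemma LINT_Iv: "(LINT s:{0<..<t}|lborel. (f s :: real)) = (\<integral>s. f s \<partial>Iv t)"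
  by (simp add: set_lebesgue_integral_def integral_restrict_space)

lemma set_integrable_Iv: "set_integrable lborel {0<..<t} (f :: real \<Rightarrow> real) \<longleftrightarrow> integrable (Iv t) f"
  by (simp add: set_integrable_def integrable_restrict_space)

lemma finite_measure_Iv: "finite_measure (Iv t)"
  by (rule finite_measureI)
    (cases "0 \<le> t"; simp add: space_restrict_space emeasure_restrict_space)

lemma Iv_measurable: "f \<in> borel_measurable borel \<Longrightarrow> f \<in> borel_measurable (Iv t)"
  by (simp add: measurable_restrict_space1)

lemma continuous_integrable_Iv:
  fixes f :: "real \<Rightarrow> real"
  assumes "continuous_on {0..t} f" shows "integrable (Iv t) f"
proof -
  have "set_integrable lborel {0..t} f"
    unfolding set_integrable_def using assms by (intro borel_integrable_compact) auto
  then have "set_integrable lborel {0<..<t} f"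
    by (rule set_integrable_subset) auto
  then show ?thesis by (simp add: set_integrable_Iv)
qed

lemma FTC_Iv:
  fixes F f :: "real \<Rightarrow> real"
  assumes t: "0 \<le> t" and F: "\<And>x. x \<in> {0..t} \<Longrightarrow> (F has_real_derivative f x) (at x)"
    and f: "\<And>x. x \<in> {0..t} \<Longrightarrow> isCont f x"
  shows "(\<integral>s. f s \<partial>Iv t) = F t - F 0"
proof -
  have "(\<integral>s. f s \<partial>Iv t) = (\<integral>s. indicator {0<..<t} s * f s \<partial>lborel)"
    by (simp add: integral_restrict_space)
  also have "\<dots> = (\<integral>s. f s * indicator {0..t} s \<partial>lborel)"
  proof (rule integral_cong_AE)
    have cont: "continuous_on {0..t} f"
      using f by (simp add: continuous_at_imp_continuous_on)
    have 1: "(\<lambda>s. indicator {0..t} s *\<^sub>R f s) \<in> borel_measurable lborel"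
      using cont by (intro borel_measurable_integrable borel_integrable_compact) auto
    then show "(\<lambda>s. f s * indicator {0..t} s) \<in> borel_measurable lborel"
      by (simp add: mult.commute)
    have "integrable (Iv t) f" using cont by (rule continuous_integrable_Iv)
    then show "(\<lambda>s. indicator {0<..<t} s * f s) \<in> borel_measurable lborel"
      by (simp add: integrable_restrict_space borel_measurable_integrable)
    have "AE s in lborel. s \<noteq> 0" "AE s in lborel. s \<noteq> t"
      by (auto intro: AE_lborel_singleton)
    then show "AE s in lborel. indicator {0<..<t} s * f s = f s * indicator {0..t} s"
      by eventually_elim (auto simp: indicator_def)
  qed
  also have "\<dots> = F t - F 0"
    by (rule integral_FTC_Icc_real) (use assms in auto)
  finally show ?thesis .
qed

section \<open>Averages against smooth bumps of unit mass\<close>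

lemma deriv_smooth_step:
  "0 \<le> deriv smooth_step x" "x < 0 \<or> 1 < x \<Longrightarrow> deriv smooth_step x = 0"
proof -
  show "0 \<le> deriv smooth_step x"
    using smooth_has_deriv[OF smooth_smooth_step] smooth_step_mono
    by (metis mono_on_imp_deriv_nonneg interior_UNIV iso_tuple_UNIV_I)
  show "deriv smooth_step x = 0" if "x < 0 \<or> 1 < x"
  proof -
    have "open {x :: real. x < 0 \<or> 1 < x}"
      by (simp add: open_Collect_disj open_Collect_less)
    from eventually_nhds_in_open[OF this] that
    have ev: "\<forall>\<^sub>F y in nhds x. y < 0 \<or> 1 < y" by simp
    have "\<forall>\<^sub>F y in nhds x. smooth_step y = (if x < 0 then 0 else 1)"
    proof (cases "x < 0")
      case True
      then have "\<forall>\<^sub>F y in nhds x. y < 0" using eventually_nhds_in_open[of "{..<0}" x] by simp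
      then show ?thesis by eventually_elim (simp add: True smooth_step_0)
    next
      case False
      then have "\<forall>\<^sub>F y in nhds x. y > 1" using that eventually_nhds_in_open[of "{1<..}" x] by simp
      then show ?thesis by eventually_elim (simp add: False smooth_step_1)
    qed
    then have "deriv smooth_step x = deriv (\<lambda>_. if x < 0 then 0 else 1) x"
      by (rule deriv_cong_ev) simp
    then show ?thesis by simp
  qed
qed

lemma scaled_step_deriv:
  "((\<lambda>s. smooth_step (n * (s - r))) has_real_derivative n * deriv smooth_step (n * (s - r))) (at s)"
proof -
  have "((\<lambda>s. n * (s - r)) has_real_derivative n) (at s)"
    by (auto intro!: derivative_eq_intros)
  from DERIV_chain2[OF smooth_has_deriv[OF smooth_smooth_step] this] show ?thesis
    by (simp add: mult.commute)
qed

lemma scaled_step_deriv_cont: "isCont (\<lambda>s. n * deriv smooth_step (n * (s - r))) s"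
proof -
  have "isCont (\<lambda>s. n * (s - r)) s" by (intro continuous_intros)
  from isCont_o2[OF this smooth_continuous[OF smooth_deriv[OF smooth_smooth_step]]]
  show ?thesis by (intro continuous_mult continuous_const)
qed

text \<open>The derivative of the rescaled step is nonnegative, has integral one over (0, t) and
  vanishes outside [r, r + 1/n], so the integral is an average of u over that window.\<close>

lemma mollify_close:
  fixes u :: "real \<Rightarrow> real"
  assumes u: "continuous_on {0..t} u" and n: "n > 0" and r: "0 \<le> r" "r + 1 / n \<le> t"
    and close: "\<And>s. r \<le> s \<Longrightarrow> s \<le> r + 1 / n \<Longrightarrow> \<bar>u s - c\<bar> \<le> e"
  shows "\<bar>(\<integral>s. n * deriv smooth_step (n * (s - r)) * u s \<partial>Iv t) - c\<bar> \<le> e"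
proof -
  define D where "D s = n * deriv smooth_step (n * (s - r))" for s
  have dD: "((\<lambda>s. smooth_step (n * (s - r))) has_real_derivative D s) (at s)" for s
    unfolding D_def by (rule scaled_step_deriv)
  have cD: "isCont D s" for s
    unfolding D_def[abs_def] by (rule scaled_step_deriv_cont)
  have D0: "D s \<ge> 0" for s using deriv_smooth_step(1) n by (simp add: D_def)
  have t: "0 \<le> t" using r n by (meson add_nonneg_nonneg divide_nonneg_pos order_trans zero_le_one)
  have contD: "continuous_on {0..t} D"
    by (intro continuous_at_imp_continuous_on ballI cD)
  note intD = continuous_integrable_Iv[OF contD]
  have "(\<integral>s. D s \<partial>Iv t) = smooth_step (n * (t - r)) - smooth_step (n * (0 - r))"
    by (rule FTC_Iv[OF t dD cD])
  moreover have "n * (t - r) \<ge> 1" using r n by (simp add: field_simps)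
  moreover have "n * (0 - r) \<le> 0" using r n by simp
  ultimately have int1: "(\<integral>s. D s \<partial>Iv t) = 1"
    by (simp add: smooth_step_0 smooth_step_1)
  have intDu: "integrable (Iv t) (\<lambda>s. D s * u s)"
    by (intro continuous_integrable_Iv continuous_on_mult contD u)
  have "(\<integral>s. D s * u s \<partial>Iv t) - c = (\<integral>s. D s * u s - D s * c \<partial>Iv t)"
    using int1 intD intDu by (subst Bochner_Integration.integral_diff) auto
  also have "\<bar>\<dots>\<bar> \<le> (\<integral>s. \<bar>D s * u s - D s * c\<bar> \<partial>Iv t)"
    by (rule integral_abs_bound)
  also have "\<dots> \<le> (\<integral>s. D s * e \<partial>Iv t)"
  proof (rule integral_mono)
    show "integrable (Iv t) (\<lambda>s. \<bar>D s * u s - D s * c\<bar>)"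
      using intD intDu by simp    show "integrable (Iv t) (\<lambda>s. D s * e)" by (intro integrable_mult_left intD)
    fix s
    show "\<bar>D s * u s - D s * c\<bar> \<le> D s * e"
    proof (cases "r \<le> s \<and> s \<le> r + 1 / n")
      case True
      have "\<bar>D s * u s - D s * c\<bar> = D s * \<bar>u s - c\<bar>"
        using D0[of s] by (simp add: abs_mult flip: right_diff_distrib)
      also have "\<dots> \<le> D s * e"
        using True close D0 by (intro mult_left_mono) auto
      finally show ?thesis .
    next
      case False
      then have "n * (s - r) < 0 \<or> 1 < n * (s - r)"
        using n by (auto simp: field_simps mult_less_0_iff)
      then show ?thesis using deriv_smooth_step(2) by (simp add: D_def)
    qed
  qed
  also have "\<dots> = e" using int1 by simp
  finally show ?thesis by (simp add: D_def)
qed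

text \<open>The window may move with n, which allows c to be an endpoint of [0, t] while the window
  stays inside.\<close>

lemma mollify_tendsto:
  fixes u :: "real \<Rightarrow> real"
  assumes u: "continuous_on {0..t} u" and c: "c \<in> {0..t}"
    and r: "\<forall>\<^sub>F n in sequentially. 0 \<le> r n \<and> r n + 1 / real n \<le> t" and rc: "r \<longlonglongrightarrow> c"
  shows "(\<lambda>n. \<integral>s. real n * deriv smooth_step (real n * (s - r n)) * u s \<partial>Iv t) \<longlonglongrightarrow> u c"
proof (rule LIMSEQ_I)
  fix e :: real assume e: "0 < e"
  then obtain d where d: "d > 0" "\<And>s. s \<in> {0..t} \<Longrightarrow> dist s c < d \<Longrightarrow> dist (u s) (u c) < e / 2"
    using u c unfolding continuous_on_iff by (metis half_gt_zero)
  have "(\<lambda>n. r n + 1 / real n) \<longlonglongrightarrow> c + 0"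
    by (intro tendsto_add rc lim_1_over_n)
  then have "\<forall>\<^sub>F n in sequentially. dist (r n + 1 / real n) c < d"
    using d by (simp add: tendstoD)
  moreover have "\<forall>\<^sub>F n in sequentially. dist (r n) c < d" using rc d by (simp add: tendstoD)
  ultimately have "\<forall>\<^sub>F n in sequentially.
      norm ((\<integral>s. real n * deriv smooth_step (real n * (s - r n)) * u s \<partial>Iv t) - u c) < e"
    using r eventually_gt_at_top[of 0]
  proof eventually_elim
    case (elim n)
    have "\<bar>u s - u c\<bar> \<le> e / 2" if "r n \<le> s" "s \<le> r n + 1 / real n" for s
    proof -
      have "s \<in> {0..t}" using that elim by auto
      moreover have "dist s c < d" using that elim unfolding dist_real_def by linarith
      ultimately show ?thesis using d(2)[of s] by (simp add: dist_real_def)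
    qed
    with elim have "\<bar>(\<integral>s. real n * deriv smooth_step (real n * (s - r n)) * u s \<partial>Iv t) - u c\<bar> \<le> e / 2"
      by (intro mollify_close[OF u]) auto
    then show ?case using e by simp
  qed
  then show "\<exists>no. \<forall>n\<ge>no. norm ((\<integral>s. real n * deriv smooth_step (real n * (s - r n)) * u s \<partial>Iv t) - u c) < e"
    by (simp add: eventually_sequentially)
qed

text \<open>Test with a smooth plateau that rises just after 0 and falls just before b. Its
  derivative averages u near 0 and, with the opposite sign, near b, while the plateau itself tends
  to the indicator of (0, b), dominated by 1.\<close>

lemma weak_derivative_FTC:
  fixes u q :: "real \<Rightarrow> real"
  assumes u: "continuous_on {0..t} u" and q: "integrable (Iv t) q"
    and weak: "\<And>\<phi>. test_fun t \<phi> \<Longrightarrow> (\<integral>s. deriv \<phi> s * u s \<partial>Iv t) = - (\<integral>s. \<phi> s * q s \<partial>Iv t)"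
    and b: "0 \<le> b" "b \<le> t"
  shows "(\<integral>s. indicator {..<b} s * q s \<partial>Iv t) = u b - u 0"
proof (cases "b = 0")
  case True
  have "(\<integral>s. indicator {..<b} s * q s \<partial>Iv t) = (\<integral>s. 0 \<partial>Iv t)"
    by (rule Bochner_Integration.integral_cong) (auto simp: True space_restrict_space)
  then show ?thesis using True by simp
next
  case False
  with b have b0: "b > 0" by simp
  \<comment> \<open>The rise occupies [1/n, 2/n] and the fall [b - 2/n, b - 1/n], so the support is
    a compact subset of (0, t). For n > 4/b the two windows are disjoint.\<close>
  define r1 where "r1 n = 1 / real n" for n
  define r2 where "r2 n = b - 2 / real n" for n
  define D where "D r n s = real n * deriv smooth_step (real n * (s - r n))" for r n s
  define \<phi> where "\<phi> n s = smooth_step (real n * (s - r1 n)) + (-1) * smooth_step (real n * (s - r2 n))" for n s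
  have r1: "r1 \<longlonglongrightarrow> 0" unfolding r1_def by (rule lim_1_over_n)
  have "(\<lambda>n. b - 2 * (1 / real n)) \<longlonglongrightarrow> b - 2 * 0"
    by (intro tendsto_intros lim_1_over_n)
  then have r2: "r2 \<longlonglongrightarrow> b" by (simp add: r2_def[abs_def])
  have large: "\<forall>\<^sub>F n in sequentially. real n > 4 / b"
    using filterlim_real_sequentially by (simp add: filterlim_at_top_dense)
  have large_inverse: "1 / real n < b / 4" "1 / real n > 0" if "real n > 4 / b" for n
  proof -
    from that b0 have "real n > 0" by (metis divide_pos_pos less_trans zero_less_numeral)
    then show "1 / real n < b / 4" "1 / real n > 0" using that b0 by (simp_all add: field_simps)
  qed
  have d\<phi>: "(\<phi> n has_real_derivative D r1 n s + (-1) * D r2 n s) (at s)" for n s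
    unfolding \<phi>_def D_def by (intro DERIV_add DERIV_cmult scaled_step_deriv)
  have lim1: "(\<lambda>n. (\<integral>s. D r1 n s * u s \<partial>Iv t)) \<longlonglongrightarrow> u 0"
    unfolding D_def
  proof (rule mollify_tendsto[OF u _ _ r1])
    show "\<forall>\<^sub>F n in sequentially. 0 \<le> r1 n \<and> r1 n + 1 / real n \<le> t"
      using large
    proof eventually_elim
      case (elim n)
      note n4 = large_inverse[OF elim]
      then show ?case using b unfolding r1_def by linarith
    qed
  qed (use b in auto)
  have lim2: "(\<lambda>n. (\<integral>s. D r2 n s * u s \<partial>Iv t)) \<longlonglongrightarrow> u b"
    unfolding D_def
  proof (rule mollify_tendsto[OF u _ _ r2])
    show "\<forall>\<^sub>F n in sequentially. 0 \<le> r2 n \<and> r2 n + 1 / real n \<le> t"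
      using large
    proof eventually_elim
      case (elim n)
      note n4 = large_inverse[OF elim]
      have "r2 n = b - 2 * (1 / real n)" by (simp add: r2_def)
      then show ?case using b n4 by linarith
    qed
  qed (use b in auto)
  have intD: "integrable (Iv t) (\<lambda>s. D r n s * u s)" for r n
  proof -
    have "isCont (D r n) s" for s
      unfolding D_def[abs_def] by (rule scaled_step_deriv_cont)
    then show ?thesis
      by (intro continuous_integrable_Iv continuous_on_mult u) (simp add: continuous_at_imp_continuous_on)
  qed
  have test: "\<forall>\<^sub>F n in sequentially. test_fun t (\<phi> n)"
    using large
  proof eventually_elim
    case (elim n)
    note n4 = large_inverse[OF elim]
    then have n: "n > 0" by simp
    have r2n: "r2 n = b - 2 * (1 / real n)" by (simp add: r2_def)
    have sm: "smooth (\<lambda>s. smooth_step (real n * (s - r)))" for r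
      using smooth_compose[OF smooth_smooth_step smooth_affine[of "real n" "- real n * r"]]
      by (simp add: right_diff_distrib)
    have "smooth (\<phi> n)"
      unfolding \<phi>_def using smooth_lin[OF sm sm] .
    moreover have "closure {s. \<phi> n s \<noteq> 0} \<subseteq> {1 / real n .. b - 1 / real n}"
    proof (rule closure_minimal)
      show "{s. \<phi> n s \<noteq> 0} \<subseteq> {1 / real n..b - 1 / real n}"
      proof safe
        fix s assume "\<phi> n s \<noteq> 0"
        moreover have "\<phi> n s = 0" if "s < 1 / real n"
        proof -
          have "s < r1 n" "s < r2 n" using that n4 unfolding r1_def r2n by linarith+
          then have "real n * (s - r1 n) \<le> 0" "real n * (s - r2 n) \<le> 0"
            by (simp_all add: mult_le_0_iff)
          then show ?thesis by (simp add: \<phi>_def smooth_step_0)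
        qed
        moreover have "\<phi> n s = 0" if "s > b - 1 / real n"
        proof -
          have "s - r1 n \<ge> 1 / real n" "s - r2 n \<ge> 1 / real n"
            using that n4 unfolding r1_def r2n by linarith+
          then have "real n * (s - r1 n) \<ge> 1" "real n * (s - r2 n) \<ge> 1"
            using n by (simp_all add: field_simps)
          then show ?thesis by (simp add: \<phi>_def smooth_step_1)
        qed
        ultimately show "s \<in> {1 / real n..b - 1 / real n}" by force
      qed
    qed simp
    moreover have "{1 / real n .. b - 1 / real n} \<subseteq> {0<..<t}"
      using n4 b by (intro subsetI) (simp only: atLeastAtMost_iff greaterThanLessThan_iff, linarith)
    ultimately show ?case unfolding test_fun_def smooth_def by blast
  qed
  have "\<forall>\<^sub>F n in sequentially. (\<integral>s. D r2 n s * u s \<partial>Iv t) - (\<integral>s. D r1 n s * u s \<partial>Iv t) = (\<integral>s. \<phi> n s * q s \<partial>Iv t)"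
    using test
  proof eventually_elim
    case (elim n)
    have "deriv (\<phi> n) = (\<lambda>s. D r1 n s + (-1) * D r2 n s)"
      using d\<phi> by (intro ext DERIV_imp_deriv)
    with weak[OF elim] have "(\<integral>s. \<phi> n s * q s \<partial>Iv t) = - (\<integral>s. D r1 n s * u s - D r2 n s * u s \<partial>Iv t)"
      by (simp add: algebra_simps)
    then show ?case by (simp add: intD)
  qed
  moreover have "(\<lambda>n. (\<integral>s. D r2 n s * u s \<partial>Iv t) - (\<integral>s. D r1 n s * u s \<partial>Iv t)) \<longlonglongrightarrow> u b - u 0"
    by (intro tendsto_diff lim1 lim2)
  ultimately have "(\<lambda>n. \<integral>s. \<phi> n s * q s \<partial>Iv t) \<longlonglongrightarrow> u b - u 0"
    by (rule Lim_transform_eventually[rotated])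
  moreover have "(\<lambda>n. \<integral>s. \<phi> n s * q s \<partial>Iv t) \<longlonglongrightarrow> (\<integral>s. indicator {..<b} s * q s \<partial>Iv t)"
  proof (rule integral_dominated_convergence[where w="\<lambda>s. \<bar>q s\<bar>"])
    have qm: "q \<in> borel_measurable (Iv t)" using q by auto
    show "(\<lambda>s. indicator {..<b} s * q s) \<in> borel_measurable (Iv t)"
      by (rule borel_measurable_times[OF Iv_measurable qm]) simp
    show "(\<lambda>s. \<phi> n s * q s) \<in> borel_measurable (Iv t)" for n
    proof (rule borel_measurable_times[OF Iv_measurable qm])
      have "continuous_on UNIV (\<phi> n)" using DERIV_isCont[OF d\<phi>] by (simp add: continuous_at_imp_continuous_on)
      then show "\<phi> n \<in> borel_measurable borel" by (rule borel_measurable_continuous_onI)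
    qed
    show "integrable (Iv t) (\<lambda>s. \<bar>q s\<bar>)" using q by auto
    have "norm (\<phi> n s) \<le> 1" for n s
      using smooth_step_bounds[of "real n * (s - r1 n)"] smooth_step_bounds[of "real n * (s - r2 n)"]
      by (auto simp: \<phi>_def)
    then show "AE s in Iv t. norm (\<phi> n s * q s) \<le> \<bar>q s\<bar>" for n
      by (auto simp: abs_mult mult_left_le_one_le)
    have "(\<lambda>n. \<phi> n s * q s) \<longlonglongrightarrow> indicator {..<b} s * q s" if s: "s \<in> {0<..<t}" for s
    proof -
      have s0: "s > 0" using s by simp
      have "(\<lambda>n. 2 * (1 / real n)) \<longlonglongrightarrow> 2 * 0" by (intro tendsto_intros lim_1_over_n)
      from order_tendstoD(2)[OF this, of s] s0
      have ev1: "\<forall>\<^sub>F n in sequentially. 2 * (1 / real n) < s" by simp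
      have ev2: "\<forall>\<^sub>F n in sequentially. s < b \<longrightarrow> s < r2 n"
        using order_tendstoD(1)[OF r2, of s] by (cases "s < b") auto
      have "\<forall>\<^sub>F n in sequentially. \<phi> n s * q s = indicator {..<b} s * q s"
        using ev1 ev2 eventually_gt_at_top[of 0]
      proof eventually_elim
        case (elim n)
        have "real n * (s - r1 n) \<ge> 1" using elim s0 by (simp add: r1_def field_simps)
        moreover have "real n * (s - r2 n) \<le> 0" if "s < b"
          using elim that by (simp add: mult_le_0_iff)
        moreover have "real n * (s - r2 n) \<ge> 1" if "\<not> s < b"
        proof -
          have "real n * (2 / real n) \<le> real n * (s - r2 n)"
            using that by (intro mult_left_mono) (auto simp: r2_def)
          then show ?thesis using elim by simp
        qed
        ultimately show ?case
          by (cases "s < b") (simp_all add: \<phi>_def smooth_step_0 smooth_step_1)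
      qed
      then show ?thesis by (rule tendsto_eventually)
    qed
    then show "AE s in Iv t. (\<lambda>n. \<phi> n s * q s) \<longlonglongrightarrow> indicator {..<b} s * q s"
      by (auto simp: AE_restrict_space_iff)
  qed
  ultimately show ?thesis using LIMSEQ_unique by blast
qed

section \<open>Coercive forms\<close>

text \<open>C = 0 is allowed because the forms it is applied to may be only semidefinite. With A = 0
  it yields B = 0, the vanishing of a first variation.\<close>

lemma nonneg_quadratic_discriminant:
  fixes A B C :: real
  assumes nonneg: "\<And>x. 0 \<le> A + 2 * x * B + x\<^sup>2 * C" and C: "0 \<le> C"
  shows "B\<^sup>2 \<le> A * C"
proof (cases "C = 0")
  case True
  have "B = 0"
  proof (rule ccontr)
    assume "B \<noteq> 0"
    \<comment> \<open>At this x the expression, linear when C = 0, takes the value -1.\<close>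
    then show False using nonneg[of "- (A + 1) / (2 * B)"] True by (simp add: field_simps)
  qed
  then show ?thesis using True by simp
next
  case False
  with C have "0 < C" by simp
  then show ?thesis using nonneg[of "- B / C"] by (simp add: field_simps power2_eq_square)
qed

text \<open>Stated for an arbitrary form so that \<open>riesz\<close> also applies to (j u, j v) + h
  a(u, v), the form of an Euler step.\<close>

locale coercive_form =
  fixes a :: "'v::{real_normed_vector,complete_space} \<Rightarrow> 'v \<Rightarrow> real" and A_max A_min :: real
  assumes a_lin: "linear (\<lambda>u. a u v)" and a_sym: "a u v = a v u" and A_min: "A_min > 0"
    and a_bdd: "\<bar>a u v\<bar> \<le> A_max * norm u * norm v"
    and a_coer: "a v v \<ge> A_min * (norm v)\<^sup>2"
begin

sublocale a: bounded_bilinear a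
proof
  show "a (u + u') v = a u v + a u' v" for u u' v
    using linear_add[OF a_lin] .
  show "a u (v + v') = a u v + a u v'" for u v v'
    using linear_add[OF a_lin] by (simp add: a_sym[of u])
  show "a (r *\<^sub>R u) v = r *\<^sub>R a u v" for r u v
    using linear_cmul[OF a_lin] .
  show "a u (r *\<^sub>R v) = r *\<^sub>R a u v" for r u v
    using linear_cmul[OF a_lin] by (simp add: a_sym[of u])
  show "\<exists>K. \<forall>u v. norm (a u v) \<le> norm u * norm v * K"
    using a_bdd by (auto simp: mult_ac intro!: exI[of _ A_max])
qed

lemma a_nonneg: "0 \<le> a v v"
  using a_coer[of v] A_min by (meson mult_nonneg_nonneg order_trans less_imp_le zero_le_power2)

lemma a_eq_0_iff: "a v v = 0 \<longleftrightarrow> v = 0"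
  using a_coer[of v] A_min a.zero_left by (auto simp: mult_le_0_iff)

lemma a_le: "a v v \<le> A_max * (norm v)\<^sup>2"
  using a_bdd[of v v] by (simp add: power2_eq_square mult.assoc)

lemma a_scaled_sum: "a (u + x *\<^sub>R v) (u + x *\<^sub>R v) = a u u + 2 * x * a u v + x\<^sup>2 * a v v"
  by (simp add: a.add_left a.add_right a.scaleR_left a.scaleR_right a_sym[of v u]
      power2_eq_square algebra_simps)

lemma a_Cauchy_Schwarz: "(a u v)\<^sup>2 \<le> a u u * a v v"
  using nonneg_quadratic_discriminant[of "a u u" "a u v" "a v v"] a_nonneg[of "u + _ *\<^sub>R v"]
    a_nonneg[of v] by (simp add: a_scaled_sum)

text \<open>The representing vector minimises \<open>a u u - 2 f u\<close>; minimising sequences are Cauchy by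
  the parallelogram law.\<close>

lemma riesz:
  assumes f: "bounded_linear f"
  shows "\<exists>u. \<forall>v. a u v = f v"
proof -
  interpret f: bounded_linear f by (rule f)
  obtain K where K: "\<And>v. \<bar>f v\<bar> \<le> norm v * K" using f.bounded by auto
  define J where "J u = a u u - 2 * f u" for u
  have J_ge: "J u \<ge> - (K\<^sup>2 / A_min)" for u
  proof -
    have "0 \<le> (A_min * norm u - K)\<^sup>2 / A_min" using A_min by simp
    also have "\<dots> = A_min * (norm u)\<^sup>2 - 2 * (norm u * K) + K\<^sup>2 / A_min"
      using A_min by (simp add: field_simps power2_eq_square)
    also have "\<dots> \<le> J u + K\<^sup>2 / A_min"
      using a_coer[of u] K[of u] unfolding J_def by linarith
    finally show ?thesis by simp
  qed
  then have bdd: "bdd_below (range J)" by (auto intro!: bdd_belowI2[where m="- (K\<^sup>2 / A_min)"])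
  define m where "m = Inf (range J)"
  have m_le: "m \<le> J u" for u
    unfolding m_def by (rule cInf_lower[OF _ bdd]) simp
  have "\<exists>u. J u < m + inverse (real (Suc n))" for n
    using cInf_lessD[of "range J" "m + inverse (real (Suc n))"] by (auto simp: m_def)
  then obtain u where u: "\<And>n. J (u n) < m + inverse (real (Suc n))" by metis
  have close: "A_min * (norm (u n - u k))\<^sup>2 \<le> 2 * (inverse (real (Suc n)) + inverse (real (Suc k)))" for n k
  proof -
    have half: "a (x /\<^sub>R 2) (x /\<^sub>R 2) = a x x / 4" "f (x /\<^sub>R 2) = f x / 2" for x
      by (simp_all add: a.scaleR_left a.scaleR_right f.scaleR)
    \<comment> \<open>Parallelogram law; the midpoint has J at least m, so two near-minimisers are
      close to each other.\<close>
    have "a (u n - u k) (u n - u k) + a (u n + u k) (u n + u k) = 2 * (a (u n) (u n) + a (u k) (u k))"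
      by (simp add: a.add_left a.add_right a.diff_left a.diff_right)
    then have "a (u n - u k) (u n - u k) = 2 * (J (u n) + J (u k) - 2 * J ((u n + u k) /\<^sub>R 2))"
      unfolding J_def half by (simp add: f.add field_simps)
    also have "\<dots> \<le> 2 * (inverse (real (Suc n)) + inverse (real (Suc k)))"
    proof -
      have "2 * (x + y - 2 * z) \<le> 2 * (p + q)" if "x < m + p" "y < m + q" "m \<le> z" for x y z p q :: real
        using that by simp
      from this[OF u[of n] u[of k] m_le] show ?thesis .
    qed
    finally show ?thesis using a_coer[of "u n - u k"] by linarith
  qed
  have "Cauchy u"
  proof (rule CauchyI)
    fix e :: real assume e: "0 < e"
    then have "0 < A_min * e\<^sup>2 / 4" using A_min by simp
    then obtain N where N: "inverse (real (Suc N)) < A_min * e\<^sup>2 / 4"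
      using reals_Archimedean by blast
    have "norm (u n - u k) < e" if "n \<ge> N" "k \<ge> N" for n k
    proof -
      have nk: "inverse (real (Suc n)) \<le> inverse (real (Suc N))" "inverse (real (Suc k)) \<le> inverse (real (Suc N))"
        using that by (simp_all add: le_imp_inverse_le)
      have "A_min * (norm (u n - u k))\<^sup>2 < A_min * e\<^sup>2"
      proof -
        have "x < y" if "p \<le> r" "q \<le> r" "x \<le> 2 * (p + q)" "r < y / 4" for p q r x y :: real
          using that by simp
        from this[OF nk close N] show ?thesis .
      qed
      then have "(norm (u n - u k))\<^sup>2 < e\<^sup>2" using A_min by simp
      then show ?thesis using e by (simp add: power_less_imp_less_base)
    qed
    then show "\<exists>M. \<forall>m\<ge>M. \<forall>n\<ge>M. norm (u m - u n) < e" by blast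
  qed
  then obtain w where w: "u \<longlonglongrightarrow> w"
    using Cauchy_convergent convergent_def by blast
  have "(\<lambda>n. J (u n)) \<longlonglongrightarrow> J w"
    unfolding J_def by (intro tendsto_intros a.tendsto w f.tendsto)
  moreover have "(\<lambda>n. m + inverse (real (Suc n))) \<longlonglongrightarrow> m + 0"
    by (intro tendsto_intros LIMSEQ_inverse_real_of_nat)
  ultimately have "J w \<le> m + 0"
    by (rule LIMSEQ_le) (use u less_imp_le in blast)
  then have min: "J w \<le> J v" for v using m_le[of v] by simp
  have "a w v = f v" for v
  proof -
    \<comment> \<open>Perturbing the minimiser in direction v gives a nonnegative quadratic in x
      with zero constant term, so its linear coefficient vanishes.\<close>
    have "0 \<le> 0 + 2 * x * (a w v - f v) + x\<^sup>2 * a v v" for x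
      using min[of "w + x *\<^sub>R v"] unfolding J_def
      by (simp add: a_scaled_sum f.add f.scaleR algebra_simps)
    from nonneg_quadratic_discriminant[OF this a_nonneg] show ?thesis by simp
  qed
  then show ?thesis by blast
qed

text \<open>This is the inverse of A. The choice is unambiguous by coercivity, see
  \<open>rep_eqI\<close>.\<close>

definition rep :: "('v \<Rightarrow>\<^sub>L real) \<Rightarrow> 'v" where
  "rep f = (SOME u. \<forall>v. a u v = f v)"

lemma rep: "a (rep f) v = f v"
  unfolding rep_def using someI_ex[OF riesz[OF blinfun.bounded_linear_right]] by blast

lemma rep_eqI: "(\<And>v. a u v = blinfun_apply f v) \<Longrightarrow> rep f = u"
proof -
  assume u: "\<And>v. a u v = blinfun_apply f v"
  then have "a (rep f - u) v = 0" for v by (simp add: a.diff_left rep)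
  then have "rep f - u = 0" using a_eq_0_iff by blast
  then show ?thesis by simp
qed

lemma bounded_linear_rep: "bounded_linear rep"
proof
  show "rep (f + g) = rep f + rep g" for f g
    by (rule rep_eqI) (simp add: a.add_left rep blinfun.add_left)
  show "rep (r *\<^sub>R f) = r *\<^sub>R rep f" for r f
    by (rule rep_eqI) (simp add: a.scaleR_left rep blinfun.scaleR_left)
  have "norm (rep f) \<le> norm f * (1 / A_min)" for f
  proof (cases "rep f = 0")
    case False
    have "A_min * (norm (rep f))\<^sup>2 \<le> blinfun_apply f (rep f)" using a_coer[of "rep f"] by (simp add: rep)
    also have "\<dots> \<le> norm f * norm (rep f)" using norm_blinfun[of f "rep f"] by simp
    finally show ?thesis using False A_min by (simp add: power2_eq_square field_simps)
  qed (use A_min in simp)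
  then show "\<exists>K. \<forall>f. norm (rep f) \<le> norm f * K" by blast
qed

text \<open>By Cauchy-Schwarz for a, the supremum defining the dual norm is attained at
  \<open>rep f\<close>. Thus the norm of a weak derivative becomes the energy norm of its
  representer.\<close>

lemma Ainvhalf_norm_rep:
  assumes "\<exists>v :: 'v. v \<noteq> 0"
  shows "(Ainvhalf_norm a f)\<^sup>2 = a (rep f) (rep f)"
proof -
  let ?q = "\<lambda>v. \<bar>blinfun_apply f v\<bar> / sqrt (a v v)"
  have le: "?q v \<le> sqrt (a (rep f) (rep f))" if "v \<noteq> 0" for v
  proof -
    have pos: "0 < a v v" using that a_eq_0_iff[of v] a_nonneg[of v] by simp
    have "\<bar>blinfun_apply f v\<bar> \<le> sqrt (a (rep f) (rep f)) * sqrt (a v v)"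
      using real_le_rsqrt[of "\<bar>blinfun_apply f v\<bar>" "a (rep f) (rep f) * a v v"]
        a_Cauchy_Schwarz[of "rep f" v]
      by (simp add: rep real_sqrt_mult)
    then show ?thesis using pos by (simp add: field_simps)
  qed
  have "\<exists>v\<in>{v. v \<noteq> 0}. ?q v = sqrt (a (rep f) (rep f))"
  proof (cases "rep f = 0")
    case True
    \<comment> \<open>All quotients are zero here; a nonzero v is needed for the supremum to range
      over a nonempty set.\<close>
    then have "f v = 0" for v using rep[of f v] by (simp add: a.zero_left)
    with assms True show ?thesis by (auto simp: a.zero_left)
  next
    case False
    have "?q (rep f) = a (rep f) (rep f) / sqrt (a (rep f) (rep f))"
      using rep[of f "rep f"] a_nonneg[of "rep f"] by simp
    then have "?q (rep f) = sqrt (a (rep f) (rep f))"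
      by (simp add: real_div_sqrt a_nonneg)
    then show ?thesis using False by blast
  qed
  then have "Ainvhalf_norm a f = sqrt (a (rep f) (rep f))"
    unfolding Ainvhalf_norm_def by (intro cSup_eq_maximum) (use le in \<open>auto intro: rev_image_eqI\<close>)
  then show ?thesis by (simp add: a_nonneg)
qed

end

section \<open>Density of step functions\<close>

lemma sq_int_on_iff:
  "sq_int_on t f \<longleftrightarrow> f \<in> borel_measurable (Iv t) \<and> integrable (Iv t) (\<lambda>s. (norm (f s))\<^sup>2)"
  unfolding sq_int_on_def set_integrable_Iv set_borel_measurable_def
  by (simp add: borel_measurable_restrict_space_iff)

lemma sq_int_on_bound:
  fixes f :: "real \<Rightarrow> 'a::real_normed_vector"
  assumes "f \<in> borel_measurable (Iv t)" "integrable (Iv t) h"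
    and "\<And>s. s \<in> {0<..<t} \<Longrightarrow> (norm (f s))\<^sup>2 \<le> h s"
  shows "sq_int_on t f"
  unfolding sq_int_on_iff
proof
  note [measurable] = assms(1)
  show "integrable (Iv t) (\<lambda>s. (norm (f s))\<^sup>2)"
  proof (rule Bochner_Integration.integrable_bound[OF assms(2)])
    show "AE s in Iv t. norm ((norm (f s))\<^sup>2) \<le> norm (h s)"
      using assms(3) by (intro AE_I2) (force simp: space_restrict_space)
  qed measurable
qed (rule assms(1))

lemma sq_int_on_add:
  fixes f g :: "real \<Rightarrow> 'a::{real_normed_vector,second_countable_topology}"
  assumes "sq_int_on t f" "sq_int_on t g" shows "sq_int_on t (\<lambda>s. f s + g s)"
proof (rule sq_int_on_bound)
  show "(\<lambda>s. f s + g s) \<in> borel_measurable (Iv t)"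
    using assms unfolding sq_int_on_iff by (intro borel_measurable_add) auto
  show "integrable (Iv t) (\<lambda>s. 2 * (norm (f s))\<^sup>2 + 2 * (norm (g s))\<^sup>2)"
    using assms unfolding sq_int_on_iff by simp
  fix s
  have "(norm (f s + g s))\<^sup>2 \<le> (norm (f s) + norm (g s))\<^sup>2"
    by (intro power_mono norm_triangle_ineq) simp
  also have "\<dots> \<le> 2 * (norm (f s))\<^sup>2 + 2 * (norm (g s))\<^sup>2"
    using zero_le_power2[of "norm (f s) - norm (g s)"] by (simp add: power2_sum power2_diff)
  finally show "(norm (f s + g s))\<^sup>2 \<le> 2 * (norm (f s))\<^sup>2 + 2 * (norm (g s))\<^sup>2" .
qed

lemma sq_int_on_bounded_linear:
  assumes L: "bounded_linear L" and f: "sq_int_on t f"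
  shows "sq_int_on t (\<lambda>s. L (f s))"
proof -
  interpret L: bounded_linear L by (rule L)
  obtain K where K: "\<And>x. norm (L x) \<le> norm x * K" using L.bounded by auto
  show ?thesis
  proof (rule sq_int_on_bound)
    have "L \<in> borel_measurable borel"
      by (intro borel_measurable_continuous_onI L.continuous_on continuous_on_id)
    then show "(\<lambda>s. L (f s)) \<in> borel_measurable (Iv t)"
      using f unfolding sq_int_on_iff by (auto intro: measurable_compose)
    show "integrable (Iv t) (\<lambda>s. (norm (f s))\<^sup>2 * K\<^sup>2)"
      using f unfolding sq_int_on_iff by simp
    show "(norm (L (f s)))\<^sup>2 \<le> (norm (f s))\<^sup>2 * K\<^sup>2" for s
      using K[of "f s"] by (simp add: power_mono flip: power_mult_distrib)
  qed
qed

lemma sq_int_on_scaleR: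
  fixes f :: "real \<Rightarrow> 'a::real_normed_vector"
  shows "sq_int_on t f \<Longrightarrow> sq_int_on t (\<lambda>s. c *\<^sub>R f s)"
  by (rule sq_int_on_bounded_linear[OF bounded_linear_scaleR_right])

lemma sq_int_on_diff:
  fixes f g :: "real \<Rightarrow> 'a::{real_normed_vector,second_countable_topology}"
  assumes "sq_int_on t f" "sq_int_on t g" shows "sq_int_on t (\<lambda>s. f s - g s)"
  using sq_int_on_add[OF assms(1) sq_int_on_scaleR[OF assms(2), of "-1"]] by simp

lemma integrable_Iv_const: "integrable (Iv t) (\<lambda>_. c :: real)"
  using finite_measure_Iv by (simp add: finite_measure.integrable_const)

lemma sq_int_on_scalar:
  fixes v :: "'a::real_normed_vector"
  assumes [measurable]: "\<phi> \<in> borel_measurable borel" and "\<And>s. s \<in> {0<..<t} \<Longrightarrow> \<bar>\<phi> s\<bar> \<le> K"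
  shows "sq_int_on t (\<lambda>s. \<phi> s *\<^sub>R v)"
proof (rule sq_int_on_bound)
  have "(\<lambda>r. r *\<^sub>R v) \<in> borel_measurable borel"
    by (intro borel_measurable_continuous_onI continuous_intros)
  with assms(1) have "(\<lambda>s. \<phi> s *\<^sub>R v) \<in> borel_measurable borel"
    by (rule measurable_compose)
  then show "(\<lambda>s. \<phi> s *\<^sub>R v) \<in> borel_measurable (Iv t)"
    by (rule Iv_measurable)
  show "integrable (Iv t) (\<lambda>_. K\<^sup>2 * (norm v)\<^sup>2)" by (rule integrable_Iv_const)
  show "(norm (\<phi> s *\<^sub>R v))\<^sup>2 \<le> K\<^sup>2 * (norm v)\<^sup>2" if "s \<in> {0<..<t}" for s
    using power_mono[OF assms(2)[OF that], of 2] by (simp add: power_mult_distrib mult_right_mono)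
qed

lemma sq_int_on_indicator:
  fixes v :: "'a::real_normed_vector"
  assumes "A \<in> sets borel" shows "sq_int_on t (\<lambda>s. indicator A s *\<^sub>R v)"
  by (rule sq_int_on_scalar[where K=1]) (use assms in \<open>auto simp: indicator_def\<close>)

text \<open>From half-lines to Borel sets by a Dynkin argument, then simple functions and dominated
  convergence.\<close>

lemma sq_int_on_induct [consumes 1, case_names step add lim]:
  fixes f :: "real \<Rightarrow> 'a::{real_normed_vector,second_countable_topology}"
  assumes f: "sq_int_on t f"
    and step: "\<And>b v. P (\<lambda>s. indicator {..<b} s *\<^sub>R v)"
    and add: "\<And>f g. sq_int_on t f \<Longrightarrow> P f \<Longrightarrow> sq_int_on t g \<Longrightarrow> P g \<Longrightarrow> P (\<lambda>s. f s + g s)"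
    and lim: "\<And>f F. sq_int_on t f \<Longrightarrow> (\<And>n. sq_int_on t (F n)) \<Longrightarrow> (\<And>n. P (F n)) \<Longrightarrow>
      (\<lambda>n. \<integral>s. (norm (F n s - f s))\<^sup>2 \<partial>Iv t) \<longlonglongrightarrow> 0 \<Longrightarrow> P f"
  shows "P f"
proof -
  \<comment> \<open>P may depend on values outside (0, t). The limit rule with a constant sequence
    removes this dependence.\<close>
  have cong: "P f" if "sq_int_on t f" "sq_int_on t g" "P g" "\<And>s. s \<in> {0<..<t} \<Longrightarrow> f s = g s" for f g
  proof (rule lim[where F="\<lambda>_. g"])
    have "(\<integral>s. (norm (g s - f s))\<^sup>2 \<partial>Iv t) = (\<integral>s. 0 \<partial>Iv t)"
      using that(4) by (intro Bochner_Integration.integral_cong) (auto simp: space_restrict_space)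
    then show "(\<lambda>n::nat. \<integral>s. (norm (g s - f s))\<^sup>2 \<partial>Iv t) \<longlonglongrightarrow> 0" by simp
  qed (use that in auto)
  have dominated: "P f" if f: "sq_int_on t f" and F: "\<And>n. sq_int_on t (F n)" "\<And>n. P (F n)"
      and conv: "\<And>s. s \<in> {0<..<t} \<Longrightarrow> (\<lambda>n. F n s) \<longlonglongrightarrow> f s"
      and bound: "\<And>n s. s \<in> {0<..<t} \<Longrightarrow> (norm (F n s - f s))\<^sup>2 \<le> h s"
      and h: "integrable (Iv t) h" for f F h
  proof (rule lim[OF f F])
    have "(\<lambda>n. \<integral>s. (norm (F n s - f s))\<^sup>2 \<partial>Iv t) \<longlonglongrightarrow> (\<integral>s. 0 \<partial>Iv t)"
    proof (rule integral_dominated_convergence[where w=h])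
      show "(\<lambda>s. (norm (F n s - f s))\<^sup>2) \<in> borel_measurable (Iv t)" for n
        using sq_int_on_diff[OF F(1) f] unfolding sq_int_on_iff by (auto intro: borel_measurable_integrable)
      show "AE s in Iv t. norm ((norm (F n s - f s))\<^sup>2) \<le> h s" for n
        using bound by (intro AE_I2) (auto simp: space_restrict_space)
      have "(\<lambda>n. (norm (F n s - f s))\<^sup>2) \<longlonglongrightarrow> 0" if "s \<in> {0<..<t}" for s
      proof -
        have "(\<lambda>n. (norm (F n s - f s))\<^sup>2) \<longlonglongrightarrow> (norm (f s - f s))\<^sup>2"
          by (intro tendsto_intros conv that)
        then show ?thesis by simp
      qed
      then show "AE s in Iv t. (\<lambda>n. (norm (F n s - f s))\<^sup>2) \<longlonglongrightarrow> 0"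
        by (intro AE_I2) (auto simp: space_restrict_space)
    qed (use h in auto)
    then show "(\<lambda>n. \<integral>s. (norm (F n s - f s))\<^sup>2 \<partial>Iv t) \<longlonglongrightarrow> 0" by simp
  qed
  have zero: "P (\<lambda>s. 0)"
    using step[of 0 0] by simp
  have ind: "P (\<lambda>s. indicator A s *\<^sub>R v)" if A: "A \<in> sets borel" for A v
  proof -
    have "Int_stable (range (lessThan :: real \<Rightarrow> _))"
      by (auto simp: Int_stable_def image_iff intro: exI[of _ "min _ _"])
    moreover have "range (lessThan :: real \<Rightarrow> _) \<subseteq> Pow UNIV" by simp
    moreover have "A \<in> sigma_sets UNIV (range lessThan)" using A by (simp add: borel_Iio)
    ultimately show ?thesis
    proof (induction arbitrary: v rule: sigma_sets_induct_disjoint)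
      case (basic A) then show ?case using step by auto
    next
      case empty show ?case using zero by simp
    next
      case (compl A)
      then have A: "A \<in> sets borel" by (simp add: borel_Iio)
      \<comment> \<open>On (0, t) the indicator of the complement of A is the indicator of
        \<open>{..<t}\<close> minus that of A.\<close>
      have "P (\<lambda>s. indicator {..<t} s *\<^sub>R v + indicator A s *\<^sub>R (- v))"
        by (intro add sq_int_on_indicator step compl A) simp
      then show ?case
      proof (rule cong[rotated 2])
        show "sq_int_on t (\<lambda>s. indicator {..<t} s *\<^sub>R v + indicator A s *\<^sub>R (- v))"
          "sq_int_on t (\<lambda>s. indicator (UNIV - A) s *\<^sub>R v)"
          using A by (intro sq_int_on_indicator sq_int_on_add; simp)+
      qed (auto simp: indicator_def)
    next
      case (union A)
      then have A: "A i \<in> sets borel" for i by (auto simp: borel_Iio)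
      have Un: "P (\<lambda>s. indicator (\<Union>i<n. A i) s *\<^sub>R v)" for n
      proof (induction n)
        case (Suc n)
        have "A i \<inter> A n = {}" if "i < n" for i
          using union(1) that by (simp add: disjoint_family_on_def)
        then have "(\<Union>i<n. A i) \<inter> A n = {}" by blast
        then have "(\<lambda>s. indicator (\<Union>i<Suc n. A i) s *\<^sub>R v)
            = (\<lambda>s. indicator (\<Union>i<n. A i) s *\<^sub>R v + indicator (A n) s *\<^sub>R v)"
          by (auto simp: fun_eq_iff lessThan_Suc indicator_def)
        then show ?case
          using A by (simp add: add sq_int_on_indicator Suc union)
      qed (simp add: zero)
      show ?case
      proof (rule dominated[OF _ _ Un])
        show "sq_int_on t (\<lambda>s. indicator (\<Union> (range A)) s *\<^sub>R v)"
          using A by (intro sq_int_on_indicator) auto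
        show "sq_int_on t (\<lambda>s. indicator (\<Union>i<n. A i) s *\<^sub>R v)" for n
          using A by (intro sq_int_on_indicator) auto
        show "(\<lambda>n. indicator (\<Union>i<n. A i) s *\<^sub>R v) \<longlonglongrightarrow> indicator (\<Union> (range A)) s *\<^sub>R v" for s
          by (intro tendsto_scaleR tendsto_const LIMSEQ_indicator_UN)
        show "(norm (indicator (\<Union>i<n. A i) s *\<^sub>R v - indicator (\<Union> (range A)) s *\<^sub>R v))\<^sup>2 \<le> (norm v)\<^sup>2" for n s
          by (auto simp: indicator_def)
      qed (rule integrable_Iv_const)
    qed
  qed
  have simple: "P g \<and> sq_int_on t g" if g: "simple_function (Iv t) g" for g
  proof -
    let ?Y = "g ` space (Iv t)"
    define B where "B y = g -` {y} \<inter> space (Iv t)" for y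
    have A: "B y \<in> sets borel" if "y \<in> ?Y" for y
      using simple_functionD(2)[OF g, of "{y}"] by (auto simp: B_def sets_restrict_space)
    have fin: "finite ?Y" using simple_functionD(1)[OF g] .
    have *: "P (\<lambda>s. \<Sum>y\<in>Y. indicator (B y) s *\<^sub>R y) \<and> sq_int_on t (\<lambda>s. \<Sum>y\<in>Y. indicator (B y) s *\<^sub>R y)"
      if "finite Y" "Y \<subseteq> ?Y" for Y
      using that
    proof induction
      case empty
      then show ?case using zero sq_int_on_indicator[of "{}" t "0 :: 'a"] by simp
    next
      case (insert y Y)
      then have "B y \<in> sets borel" using A by blast
      then show ?case
        unfolding sum.insert[OF insert.hyps] using insert
        by (intro conjI add ind sq_int_on_indicator sq_int_on_add) blast+
    qed
    define G where "G s = (\<Sum>y\<in>?Y. indicator (B y) s *\<^sub>R y)" for s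
    from * [OF fin order_refl] have G: "P G" "sq_int_on t G"
      unfolding G_def[abs_def] by auto
    have eq: "g s = G s" if s: "s \<in> {0<..<t}" for s
    proof -
      have s: "s \<in> space (Iv t)" using s by (simp add: space_restrict_space)
      have "G s = (\<Sum>y\<in>?Y. if y = g s then y else 0)"
        unfolding G_def using s by (intro sum.cong) (auto simp: B_def indicator_def)
      also have "\<dots> = g s" using fin s by simp
      finally show ?thesis by simp
    qed
    have "g \<in> borel_measurable (Iv t)" using borel_measurable_simple_function[OF g] .
    then have "sq_int_on t g"
      by (rule sq_int_on_bound[where h="\<lambda>s. (norm (G s))\<^sup>2"])
        (use G(2) eq in \<open>auto simp: sq_int_on_iff\<close>)
    moreover from this have "P g"
      by (rule cong[OF _ G(2,1)]) (use eq in auto)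
    ultimately show ?thesis by blast
  qed
  from f have "f \<in> borel_measurable (Iv t)" by (simp add: sq_int_on_iff)
  from borel_measurable_implies_sequence_metric[OF this, of 0]
  obtain F where F: "\<forall>i. simple_function (Iv t) (F i)"
    and conv: "\<forall>s\<in>space (Iv t). (\<lambda>i. F i s) \<longlonglongrightarrow> f s"
    and bound: "\<forall>i. \<forall>s\<in>space (Iv t). dist (F i s) 0 \<le> 2 * dist (f s) 0"
    by blast
  show ?thesis
  proof (rule dominated[OF f])
    \<comment> \<open>The simple functions satisfy |F n s| \<le> 2 |f s|, hence the factor
      3.\<close>
    show "(norm (F n s - f s))\<^sup>2 \<le> (3 * norm (f s))\<^sup>2" if "s \<in> {0<..<t}" for n s
    proof (rule power_mono)
      show "norm (F n s - f s) \<le> 3 * norm (f s)"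
      proof -
        have "norm (F n s) \<le> 2 * norm (f s)" using bound that by (simp add: space_restrict_space)
        then show ?thesis using norm_triangle_ineq4[of "F n s" "f s"] by linarith
      qed
    qed simp
    show "integrable (Iv t) (\<lambda>s. (3 * norm (f s))\<^sup>2)"
      using f by (simp add: power_mult_distrib sq_int_on_iff)
  qed (use simple F conv in \<open>auto simp: space_restrict_space\<close>)
qed

section \<open>Integration by parts against ramps\<close>

text \<open>Together with constants, ramps generate the piecewise linear functions of time on
  [0, t]; those with c \<le> t vanish at t.\<close>

definition ramp :: "real \<Rightarrow> real \<Rightarrow> real" where
  "ramp c s = max 0 (c - s)"

lemma continuous_on_ramp: "continuous_on S (ramp c)"
  unfolding ramp_def[abs_def] by (intro continuous_intros)

lemma ramp_measurable [measurable]: "ramp c \<in> borel_measurable borel"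
  by (intro borel_measurable_continuous_onI continuous_on_ramp)

lemma ramp_bound: "0 < s \<Longrightarrow> \<bar>ramp c s\<bar> \<le> \<bar>c\<bar>"
  by (auto simp: ramp_def)

lemma LINT_Iv_interval:
  assumes "0 \<le> b" "b \<le> c" "c \<le> t"
  shows "(\<integral>s. indicator {b..<c} s \<partial>Iv t) = c - b"
proof -
  have "(\<integral>s. (indicator {b..<c} s :: real) \<partial>Iv t) = (\<integral>s. indicator {b..<c} s \<partial>lborel)"
  proof (subst integral_restrict_space, simp, rule integral_cong_AE)
    show "AE s in lborel. indicator {0<..<t} s *\<^sub>R indicator {b..<c} s = (indicator {b..<c} s :: real)"
      using AE_lborel_singleton[of 0]
      by (rule eventually_mono) (use assms in \<open>auto simp: indicator_def\<close>)
  qed simp_all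
  then show ?thesis using assms by simp
qed

lemma LINT_Iv_lessThan:
  assumes "0 \<le> c" "c \<le> t"
  shows "(\<integral>s. indicator {..<c} s \<partial>Iv t) = c"
proof -
  have "(\<integral>s. indicator {..<c} s \<partial>Iv t) = (\<integral>s. (indicator {0..<c} s :: real) \<partial>Iv t)"
    by (rule Bochner_Integration.integral_cong) (auto simp: space_restrict_space indicator_def)
  then show ?thesis using LINT_Iv_interval[of 0 c t] assms by simp
qed

lemma integrable_mult_bounded:
  fixes q \<phi> :: "real \<Rightarrow> real"
  assumes q: "integrable (Iv t) q" and [measurable]: "\<phi> \<in> borel_measurable borel"
    and b: "\<And>s. s \<in> {0<..<t} \<Longrightarrow> \<bar>\<phi> s\<bar> \<le> K"
  shows "integrable (Iv t) (\<lambda>s. \<phi> s * q s)"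
proof (rule Bochner_Integration.integrable_bound[of _ "\<lambda>s. K * q s"])
  show "(\<lambda>s. \<phi> s * q s) \<in> borel_measurable (Iv t)"
    by (rule borel_measurable_times[OF Iv_measurable borel_measurable_integrable[OF q]]) measurable
  show "AE s in Iv t. norm (\<phi> s * q s) \<le> norm (K * q s)"
    using b by (intro AE_I2) (fastforce simp: space_restrict_space abs_mult intro: mult_right_mono)
qed (use q in simp)

text \<open>\<open>ramp c s\<close> is the length of [s, c). Writing it as an integral over \<tau>
  and exchanging the order on the triangle s \<le> \<tau> < c leaves, for each \<tau>, the integral
  of q up to \<tau>. Only the primitive property of u is used, no differentiability.\<close>

lemma ramp_parts:
  fixes u q :: "real \<Rightarrow> real"
  assumes q: "integrable (Iv t) q"
    and prim: "\<And>b. 0 \<le> b \<Longrightarrow> b \<le> t \<Longrightarrow> (\<integral>s. indicator {..<b} s * q s \<partial>Iv t) = u b - u 0"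
    and c: "0 \<le> c" "c \<le> t"
  shows "(\<integral>s. ramp c s * q s \<partial>Iv t) = (\<integral>s. indicator {..<c} s * (u s - u 0) \<partial>Iv t)"
proof -
  interpret finite_measure "Iv t" by (rule finite_measure_Iv)
  interpret pair_sigma_finite "Iv t" "Iv t" ..
  define f where "f s \<tau> = indicator {s..<c} \<tau> * q s" for s \<tau> :: real
  have q_meas [measurable]: "q \<in> borel_measurable (Iv t)" using q by simp
  have id_meas [measurable]: "(\<lambda>s. s) \<in> borel_measurable (Iv t)" by (intro Iv_measurable) simp
  have inner: "(\<integral>\<tau>. indicator {s..<c} \<tau> * r \<partial>Iv t) = ramp c s * r" if "s \<in> {0<..<t}" for s r
  proof (cases "s \<le> c")
    case True
    then show ?thesis using LINT_Iv_interval[of s c t] that c by (simp add: ramp_def)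
  next
    case False
    then show ?thesis by (simp add: ramp_def)
  qed
  have int_f: "integrable (Iv t \<Otimes>\<^sub>M Iv t) (case_prod f)"
  proof (rule Fubini_integrable)
    have "case_prod f = (\<lambda>p. (if fst p \<le> snd p \<and> snd p < c then 1 else 0) * q (fst p))"
      by (auto simp: fun_eq_iff f_def indicator_def)
    then show "case_prod f \<in> borel_measurable (Iv t \<Otimes>\<^sub>M Iv t)" by simp
    have "integrable (Iv t) (\<lambda>s. ramp c s * \<bar>q s\<bar>)"
      using q ramp_bound by (intro integrable_mult_bounded[where K="\<bar>c\<bar>"]) auto
    moreover have "(\<integral>\<tau>. norm (case_prod f (s, \<tau>)) \<partial>Iv t) = ramp c s * \<bar>q s\<bar>" if "s \<in> {0<..<t}" for s
      using inner[OF that, of "\<bar>q s\<bar>"] by (simp add: f_def abs_mult)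
    ultimately show "integrable (Iv t) (\<lambda>s. \<integral>\<tau>. norm (case_prod f (s, \<tau>)) \<partial>Iv t)"
      by (subst Bochner_Integration.integrable_cong[OF refl]) (auto simp: space_restrict_space)
    show "AE s in Iv t. integrable (Iv t) (\<lambda>\<tau>. case_prod f (s, \<tau>))"
    proof (intro AE_I2)
      fix s
      show "integrable (Iv t) (\<lambda>\<tau>. case_prod f (s, \<tau>))"
        using integrable_mult_bounded[OF integrable_Iv_const[of t "q s"], of "indicator {s..<c}" 1]
        by (auto simp: f_def indicator_def)
    qed
  qed
  have "(\<integral>s. ramp c s * q s \<partial>Iv t) = (\<integral>s. (\<integral>\<tau>. f s \<tau> \<partial>Iv t) \<partial>Iv t)"
  proof (rule Bochner_Integration.integral_cong[OF refl])
    fix s assume "s \<in> space (Iv t)"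
    then have "s \<in> {0<..<t}" by (simp add: space_restrict_space)
    from inner[OF this, of "q s"] show "ramp c s * q s = (\<integral>\<tau>. f s \<tau> \<partial>Iv t)"
      unfolding f_def by (rule sym)
  qed
  also have "\<dots> = (\<integral>\<tau>. (\<integral>s. f s \<tau> \<partial>Iv t) \<partial>Iv t)"
    by (rule Fubini_integral[OF int_f, symmetric])
  also have "\<dots> = (\<integral>\<tau>. indicator {..<c} \<tau> * (u \<tau> - u 0) \<partial>Iv t)"
  proof (rule Bochner_Integration.integral_cong[OF refl])
    fix \<tau> assume "\<tau> \<in> space (Iv t)"
    then have \<tau>: "0 < \<tau>" "\<tau> < t" by (auto simp: space_restrict_space)
    have "(\<integral>s. f s \<tau> \<partial>Iv t) = (\<integral>s. indicator {..<c} \<tau> * (indicator {..<\<tau>} s * q s) \<partial>Iv t)"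
    proof (rule integral_cong_AE)
      show "(\<lambda>s. f s \<tau>) \<in> borel_measurable (Iv t)"
      proof -
        have "(\<lambda>s. f s \<tau>) = (\<lambda>s. (if s \<le> \<tau> \<and> \<tau> < c then 1 else 0) * q s)"
          by (auto simp: fun_eq_iff f_def indicator_def)
        then show ?thesis by simp
      qed
      \<comment> \<open>The triangle gives s \<le> \<tau>, the primitive s < \<tau>; they differ at
        one point.\<close>
      have "AE s in lborel. s \<noteq> \<tau>" by (rule AE_lborel_singleton)
      then have "AE s in Iv t. s \<noteq> \<tau>" by (simp add: AE_restrict_space_iff) (auto elim: eventually_mono)
      then show "AE s in Iv t. f s \<tau> = indicator {..<c} \<tau> * (indicator {..<\<tau>} s * q s)"
        by eventually_elim (auto simp: f_def indicator_def)
      have "(\<lambda>s. indicator {..<\<tau>} s * q s) \<in> borel_measurable (Iv t)"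
        by (rule borel_measurable_times[OF Iv_measurable q_meas]) simp
      then show "(\<lambda>s. indicator {..<c} \<tau> * (indicator {..<\<tau>} s * q s)) \<in> borel_measurable (Iv t)"
        by simp
    qed
    then show "(\<integral>s. f s \<tau> \<partial>Iv t) = indicator {..<c} \<tau> * (u \<tau> - u 0)"
      using prim[of \<tau>] \<tau> by simp
  qed
  finally show ?thesis .
qed

section \<open>Trajectories with an integration by parts formula\<close>

lemma test_fun_smooth: "test_fun t \<phi> \<Longrightarrow> smooth \<phi>"
  by (simp add: test_fun_def smooth_def)

lemma test_fun_outside:
  assumes "test_fun t \<phi>" "s \<notin> {0<..<t}" shows "\<phi> s = 0"
proof (rule ccontr)
  assume "\<phi> s \<noteq> 0"
  then have "s \<in> {s. \<phi> s \<noteq> 0}" by simp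
  then have cl: "s \<in> closure {s. \<phi> s \<noteq> 0}" by (rule subsetD[OF closure_subset])
  have "closure {s. \<phi> s \<noteq> 0} \<subseteq> {0<..<t}"
    using assms(1) by (simp only: test_fun_def)
  from subsetD[OF this cl] assms(2) show False by (rule notE[rotated])
qed

locale gelfand_form = coercive_form a A_max A_min
  for a :: "'v::{real_inner,complete_space,second_countable_topology} \<Rightarrow> 'v \<Rightarrow> real" and A_max A_min +
  fixes j :: "'v \<Rightarrow> 'h::{real_inner,complete_space,second_countable_topology}" and t :: real
  assumes j: "bounded_linear j" and j_dense: "closure (range j) = UNIV"
    and V_nontriv: "\<exists>v :: 'v. v \<noteq> 0" and t: "0 < t"
begin

sublocale j: bounded_linear j by (rule j)

section \<open>The energy inner product on square integrable V-valued functions\<close>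

definition ip :: "(real \<Rightarrow> 'v) \<Rightarrow> (real \<Rightarrow> 'v) \<Rightarrow> real" where
  "ip p q = (\<integral>s. a (p s) (q s) \<partial>Iv t)"

lemma integrable_form:
  assumes p: "sq_int_on t p" and q: "sq_int_on t q"
  shows "integrable (Iv t) (\<lambda>s. a (p s) (q s))"
proof (rule Bochner_Integration.integrable_bound)
  show "integrable (Iv t) (\<lambda>s. \<bar>A_max\<bar> * ((norm (p s))\<^sup>2 + (norm (q s))\<^sup>2))"
    using p q by (simp add: sq_int_on_iff)
  have "continuous_on UNIV (\<lambda>x. a (fst x) (snd x))"
    by (intro a.continuous_on continuous_on_fst continuous_on_snd continuous_on_id)
  then show "(\<lambda>s. a (p s) (q s)) \<in> borel_measurable (Iv t)"
    using p q by (intro borel_measurable_continuous_Pair[where H=a]) (auto simp: sq_int_on_iff)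
  have "norm (a u v) \<le> norm (\<bar>A_max\<bar> * ((norm u)\<^sup>2 + (norm v)\<^sup>2))" for u v
  proof -
    have "0 \<le> (norm u - norm v)\<^sup>2" by simp
    then have "2 * (norm u * norm v) \<le> (norm u)\<^sup>2 + (norm v)\<^sup>2"
      by (simp add: power2_diff)
    moreover have "0 \<le> norm u * norm v" by simp
    ultimately have "norm u * norm v \<le> (norm u)\<^sup>2 + (norm v)\<^sup>2" by linarith
    then have "\<bar>A_max\<bar> * (norm u * norm v) \<le> \<bar>A_max\<bar> * ((norm u)\<^sup>2 + (norm v)\<^sup>2)"
      by (intro mult_left_mono) auto
    moreover have "A_max * (norm u * norm v) \<le> \<bar>A_max\<bar> * (norm u * norm v)"
      by (intro mult_right_mono) auto
    ultimately show ?thesis using a_bdd[of u v] by (simp add: mult.assoc)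
  qed
  then show "AE s in Iv t. norm (a (p s) (q s)) \<le> norm (\<bar>A_max\<bar> * ((norm (p s))\<^sup>2 + (norm (q s))\<^sup>2))"
    by simp
qed

lemma ip_sym: "ip p q = ip q p"
  unfolding ip_def by (simp add: a_sym)

lemma ip_cong: "(\<And>s. s \<in> {0<..<t} \<Longrightarrow> p s = p' s) \<Longrightarrow> (\<And>s. s \<in> {0<..<t} \<Longrightarrow> q s = q' s) \<Longrightarrow> ip p q = ip p' q'"
  unfolding ip_def by (intro Bochner_Integration.integral_cong) (auto simp: space_restrict_space)

lemma ip_lin_left:
  assumes "sq_int_on t p" "sq_int_on t p'" "sq_int_on t q"
  shows "ip (\<lambda>s. p s + c *\<^sub>R p' s) q = ip p q + c * ip p' q"
  using assms by (simp add: ip_def a.add_left a.scaleR_left integrable_form)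

lemma ip_lin_right:
  assumes "sq_int_on t p" "sq_int_on t p'" "sq_int_on t q"
  shows "ip q (\<lambda>s. p s + c *\<^sub>R p' s) = ip q p + c * ip q p'"
  using ip_lin_left[OF assms] by (simp add: ip_sym[of q])

lemma ip_diff_left:
  "sq_int_on t p \<Longrightarrow> sq_int_on t p' \<Longrightarrow> sq_int_on t q \<Longrightarrow> ip (\<lambda>s. p s - p' s) q = ip p q - ip p' q"
  using ip_lin_left[of p p' q "-1"] by simp

lemma ip_diff_right:
  "sq_int_on t p \<Longrightarrow> sq_int_on t p' \<Longrightarrow> sq_int_on t q \<Longrightarrow> ip q (\<lambda>s. p s - p' s) = ip q p - ip q p'"
  using ip_lin_right[of p p' q "-1"] by simp

lemma ip_nonneg: "0 \<le> ip p p"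
  unfolding ip_def by (rule integral_nonneg_AE) (simp add: a_nonneg)

lemma ip_zero [simp]: "ip (\<lambda>_. 0) q = 0" "ip q (\<lambda>_. 0) = 0"
  by (simp_all add: ip_def a.zero_left a.zero_right)

lemma sq_int_on_const: "sq_int_on t (\<lambda>_. v :: 'a::real_normed_vector)"
  using sq_int_on_scalar[of "\<lambda>_. 1" t 1 v] by simp

lemma sq_int_on_lin:
  fixes f g :: "real \<Rightarrow> 'a::{real_normed_vector,second_countable_topology}"
  shows "sq_int_on t f \<Longrightarrow> sq_int_on t g \<Longrightarrow> sq_int_on t (\<lambda>s. f s + c *\<^sub>R g s)"
  by (intro sq_int_on_add sq_int_on_scaleR)

lemma ip_scaled_sum:
  assumes "sq_int_on t p" "sq_int_on t q"
  shows "ip (\<lambda>s. p s + x *\<^sub>R q s) (\<lambda>s. p s + x *\<^sub>R q s) = ip p p + 2 * x * ip p q + x\<^sup>2 * ip q q"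
  using assms by (simp add: ip_lin_left ip_lin_right sq_int_on_lin ip_sym[of q p] power2_eq_square algebra_simps)

text \<open>Three summands serve both norms: the X^t norm uses all of them, the norm of Y^t x H
  takes r and r' zero.\<close>

lemma ip_Cauchy_Schwarz:
  fixes h h' :: 'h
  assumes "sq_int_on t p" "sq_int_on t p'" "sq_int_on t r" "sq_int_on t r'"
  shows "(ip p p' + ip r r' + inner h h')\<^sup>2
    \<le> (ip p p + ip r r + (norm h)\<^sup>2) * (ip p' p' + ip r' r' + (norm h')\<^sup>2)"
proof (rule nonneg_quadratic_discriminant)
  fix x
  have norm_sum: "(norm (h + x *\<^sub>R h'))\<^sup>2 = (norm h)\<^sup>2 + 2 * x * inner h h' + x\<^sup>2 * (norm h')\<^sup>2"
    unfolding power2_norm_eq_inner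
    by (simp add: inner_add_left inner_add_right inner_commute[of h' h] power2_eq_square algebra_simps)
  have "0 \<le> ip (\<lambda>s. p s + x *\<^sub>R p' s) (\<lambda>s. p s + x *\<^sub>R p' s)
      + ip (\<lambda>s. r s + x *\<^sub>R r' s) (\<lambda>s. r s + x *\<^sub>R r' s) + (norm (h + x *\<^sub>R h'))\<^sup>2"
    by (intro add_nonneg_nonneg ip_nonneg zero_le_power2)
  also have "\<dots> = ip p p + ip r r + (norm h)\<^sup>2 + 2 * x * (ip p p' + ip r r' + inner h h')
      + x\<^sup>2 * (ip p' p' + ip r' r' + (norm h')\<^sup>2)"
    using assms by (simp add: ip_scaled_sum norm_sum algebra_simps)
  finally show "0 \<le> \<dots>" .
qed (simp add: ip_nonneg)

text \<open>This is the operator A itself, inverse to \<open>rep\<close>.\<close>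

definition emb :: "'v \<Rightarrow> ('v \<Rightarrow>\<^sub>L real)" where
  "emb w = Blinfun (a w)"

lemma emb [simp]: "blinfun_apply (emb w) v = a w v"
  by (simp add: emb_def bounded_linear_Blinfun_apply a.bounded_linear_right)

lemma bounded_linear_emb: "bounded_linear emb"
proof (rule bounded_linear_intro)
  show "emb (u + v) = emb u + emb v" for u v
    by (rule blinfun_eqI) (simp add: a.add_left blinfun.add_left)
  show "emb (r *\<^sub>R u) = r *\<^sub>R emb u" for r u
    by (rule blinfun_eqI) (simp add: a.scaleR_left blinfun.scaleR_left)
  show "norm (emb u) \<le> norm u * \<bar>A_max\<bar>" for u
  proof (rule norm_blinfun_bound)
    fix v
    have "norm (emb u v) \<le> A_max * (norm u * norm v)" using a_bdd[of u v] by (simp add: mult.assoc)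
    also have "\<dots> \<le> \<bar>A_max\<bar> * (norm u * norm v)" by (intro mult_right_mono) auto
    finally show "norm (emb u v) \<le> norm u * \<bar>A_max\<bar> * norm v" by (simp add: mult_ac)
  qed simp
qed

lemma emb_rep: "emb (rep g) = g"
  by (rule blinfun_eqI) (simp add: rep)

lemma rep_emb [simp]: "rep (emb w) = w"
  by (rule rep_eqI) simp

text \<open>Elements of \<open>X\<^sup>t\<close> with the weak derivative replaced by its Riesz representer
  \<open>w = A\<inverse> x'\<close>; since \<open>'v\<close> is second countable, sums of such \<open>w\<close> are measurable.\<close>

definition traj :: "(real \<Rightarrow> 'h) \<Rightarrow> (real \<Rightarrow> 'v) \<Rightarrow> (real \<Rightarrow> 'v) \<Rightarrow> bool" where
  "traj xh xv w \<longleftrightarrow> in_X j t xh xv (\<lambda>s. emb (w s))"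

lemma traj_rep: "in_X j t xh xv g \<longleftrightarrow> traj xh xv (\<lambda>s. rep (g s))"
  by (simp add: traj_def emb_rep)

lemma sq_int_on_emb: "sq_int_on t (\<lambda>s. emb (w s)) \<longleftrightarrow> sq_int_on t w"
  using sq_int_on_bounded_linear[OF bounded_linear_emb, of t w]
    sq_int_on_bounded_linear[OF bounded_linear_rep, of t "\<lambda>s. emb (w s)"] by auto

lemma traj_iff:
  "traj xh xv w \<longleftrightarrow> sq_int_on t xv \<and> continuous_on {0..t} xh \<and>
     (AE s in Iv t. j (xv s) = xh s) \<and> sq_int_on t w \<and>
     (\<forall>\<phi> v. test_fun t \<phi> \<longrightarrow>
        (\<integral>s. deriv \<phi> s * inner (xh s) (j v) \<partial>Iv t) = - (\<integral>s. \<phi> s * a (w s) v \<partial>Iv t))"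
  unfolding traj_def in_X_def weak_deriv_dual_def LINT_Iv sq_int_on_emb emb
  by (simp add: AE_restrict_space_iff)

lemma trajD:
  assumes "traj xh xv w"
  shows "sq_int_on t xv" "continuous_on {0..t} xh" "AE s in Iv t. j (xv s) = xh s" "sq_int_on t w"
    "test_fun t \<phi> \<Longrightarrow> (\<integral>s. deriv \<phi> s * inner (xh s) (j v) \<partial>Iv t) = - (\<integral>s. \<phi> s * a (w s) v \<partial>Iv t)"
  using assms unfolding traj_iff by blast+

lemma integrable_form_const: "sq_int_on t w \<Longrightarrow> integrable (Iv t) (\<lambda>s. a (w s) v)"
  using integrable_form[OF _ sq_int_on_const] .

lemma traj_lin:
  assumes x: "traj xh xv w" and y: "traj yh yv z"
  shows "traj (\<lambda>s. xh s + c *\<^sub>R yh s) (\<lambda>s. xv s + c *\<^sub>R yv s) (\<lambda>s. w s + c *\<^sub>R z s)"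
  unfolding traj_iff
proof (intro conjI allI impI sq_int_on_lin trajD(1,4)[OF x] trajD(1,4)[OF y])
  show "continuous_on {0..t} (\<lambda>s. xh s + c *\<^sub>R yh s)"
    by (intro continuous_intros trajD(2)[OF x] trajD(2)[OF y])
  show "AE s in Iv t. j (xv s + c *\<^sub>R yv s) = xh s + c *\<^sub>R yh s"
    using trajD(3)[OF x] trajD(3)[OF y] by eventually_elim (simp add: j.add j.scaleR)
  fix \<phi> v assume \<phi>: "test_fun t \<phi>"
  have sm: "smooth \<phi>" using test_fun_smooth[OF \<phi>] .
  have c1: "continuous_on {0..t} (deriv \<phi>)" "continuous_on S \<phi>" for S
    using smooth_continuous[OF sm] smooth_continuous[OF smooth_deriv[OF sm]]
    by (simp_all add: continuous_at_imp_continuous_on)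
  have int1: "integrable (Iv t) (\<lambda>s. deriv \<phi> s * inner (xh s) (j v))"
    "integrable (Iv t) (\<lambda>s. deriv \<phi> s * inner (yh s) (j v))"
    by (intro continuous_integrable_Iv continuous_intros c1 trajD(2)[OF x] trajD(2)[OF y])+
  have "bounded (\<phi> ` {0..t})"
    by (intro compact_imp_bounded compact_continuous_image c1 compact_Icc)
  then obtain K where "\<forall>r\<in>\<phi> ` {0..t}. norm r \<le> K" unfolding bounded_iff by blast
  then have K: "\<bar>\<phi> s\<bar> \<le> K" if "s \<in> {0<..<t}" for s using that by auto
  have int2: "integrable (Iv t) (\<lambda>s. \<phi> s * a (w' s) v)" if "sq_int_on t w'" for w'
    using K by (intro integrable_mult_bounded[OF integrable_form_const[OF that], of _ K]
        borel_measurable_continuous_onI c1)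
  show "(\<integral>s. deriv \<phi> s * inner (xh s + c *\<^sub>R yh s) (j v) \<partial>Iv t)
      = - (\<integral>s. \<phi> s * a (w s + c *\<^sub>R z s) v \<partial>Iv t)"
    using trajD(5)[OF x \<phi>, of v] trajD(5)[OF y \<phi>, of v] int1
      int2[OF trajD(4)[OF x]] int2[OF trajD(4)[OF y]]
    by (simp add: inner_add_left a.add_left a.scaleR_left distrib_left mult.left_commute)
qed

text \<open>The scalar function s -> (x(s), j v) is continuous with weak derivative a(w, v), so
  \<open>weak_derivative_FTC\<close> applies. All further information on the derivative of an
  arbitrary trajectory comes from this identity.\<close>

lemma traj_step:
  assumes x: "traj xh xv w" and b: "0 \<le> b" "b \<le> t"
  shows "(\<integral>s. indicator {..<b} s * a (w s) v \<partial>Iv t) = inner (xh b) (j v) - inner (xh 0) (j v)"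
proof (rule weak_derivative_FTC[OF _ integrable_form_const[OF trajD(4)[OF x]] trajD(5)[OF x] b])
  show "continuous_on {0..t} (\<lambda>s. inner (xh s) (j v))"
    by (rule continuous_on_inner[OF trajD(2)[OF x] continuous_on_const])
qed

text \<open>The left side is the integral of <y', x> + <x', y>, because z and w represent y' and x'.
  Quantifying over all y makes the property linear in x, so that it only has to be checked on
  constants and ramps.\<close>

definition nice :: "(real \<Rightarrow> 'h) \<Rightarrow> (real \<Rightarrow> 'v) \<Rightarrow> (real \<Rightarrow> 'v) \<Rightarrow> bool" where
  "nice xh xv w \<longleftrightarrow> traj xh xv w \<and> (\<forall>yh yv z. traj yh yv z \<longrightarrow>
     ip z xv + ip w yv = inner (yh t) (xh t) - inner (yh 0) (xh 0))"

lemma nice_lin: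
  assumes x: "nice xh xv w" and y: "nice yh yv z"
  shows "nice (\<lambda>s. xh s + c *\<^sub>R yh s) (\<lambda>s. xv s + c *\<^sub>R yv s) (\<lambda>s. w s + c *\<^sub>R z s)"
  unfolding nice_def
proof (intro conjI allI impI)
  have tx: "traj xh xv w" and ty: "traj yh yv z" using x y by (simp_all add: nice_def)
  show "traj (\<lambda>s. xh s + c *\<^sub>R yh s) (\<lambda>s. xv s + c *\<^sub>R yv s) (\<lambda>s. w s + c *\<^sub>R z s)"
    by (rule traj_lin[OF tx ty])
  fix uh uv r assume u: "traj uh uv r"
  have "ip r xv + ip w uv = inner (uh t) (xh t) - inner (uh 0) (xh 0)"
    "ip r yv + ip z uv = inner (uh t) (yh t) - inner (uh 0) (yh 0)"
    using x y u by (simp_all add: nice_def)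
  then have "ip r xv + ip w uv + c * (ip r yv + ip z uv)
      = inner (uh t) (xh t) - inner (uh 0) (xh 0) + c * (inner (uh t) (yh t) - inner (uh 0) (yh 0))"
    by simp
  with trajD(1,4)[OF tx] trajD(1,4)[OF ty] trajD(1,4)[OF u] show "ip r (\<lambda>s. xv s + c *\<^sub>R yv s) + ip (\<lambda>s. w s + c *\<^sub>R z s) uv
      = inner (uh t) (xh t + c *\<^sub>R yh t) - inner (uh 0) (xh 0 + c *\<^sub>R yh 0)"
    by (simp add: ip_lin_left ip_lin_right inner_add_right algebra_simps)
qed

lemma LINT_deriv_test_fun:
  assumes \<phi>: "test_fun t \<phi>"
  shows "integrable (Iv t) (deriv \<phi>)"
    and "\<And>b. 0 \<le> b \<Longrightarrow> b \<le> t \<Longrightarrow> (\<integral>s. indicator {..<b} s * deriv \<phi> s \<partial>Iv t) = \<phi> b - \<phi> 0"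
proof -
  have sm: "smooth \<phi>" using test_fun_smooth[OF \<phi>] .
  show "integrable (Iv t) (deriv \<phi>)"
    using smooth_continuous[OF smooth_deriv[OF sm]]
    by (intro continuous_integrable_Iv) (simp add: continuous_at_imp_continuous_on)
  fix b :: real assume b: "0 \<le> b" "b \<le> t"
  have "(\<integral>s. indicator {..<b} s * deriv \<phi> s \<partial>Iv t) = (\<integral>s. deriv \<phi> s \<partial>Iv b)"
    using b by (auto simp: integral_restrict_space indicator_def intro!: Bochner_Integration.integral_cong)
  also have "\<dots> = \<phi> b - \<phi> 0"
    by (rule FTC_Iv[OF b(1) smooth_has_deriv[OF sm] smooth_continuous[OF smooth_deriv[OF sm]]])
  finally show "(\<integral>s. indicator {..<b} s * deriv \<phi> s \<partial>Iv t) = \<phi> b - \<phi> 0" .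
qed

lemma indicator_Iv: "(\<integral>s. indicator {..<t} s * f s \<partial>Iv t) = (\<integral>s. (f s :: real) \<partial>Iv t)"
  by (rule Bochner_Integration.integral_cong) (auto simp: space_restrict_space)

lemma nice_const: "nice (\<lambda>_. j v) (\<lambda>_. v) (\<lambda>_. 0)"
  unfolding nice_def
proof (intro conjI allI impI)
  show "traj (\<lambda>_. j v) (\<lambda>_. v) (\<lambda>_. 0)"
    unfolding traj_iff
  proof (intro conjI allI impI)
    fix \<phi> v' assume \<phi>: "test_fun t \<phi>"
    have "(\<integral>s. deriv \<phi> s \<partial>Iv t) = 0"
      using LINT_deriv_test_fun(2)[OF \<phi>, of t] t test_fun_outside[OF \<phi>]
      by (simp add: indicator_Iv)
    then show "(\<integral>s. deriv \<phi> s * inner (j v) (j v') \<partial>Iv t) = - (\<integral>s. \<phi> s * a 0 v' \<partial>Iv t)"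
      by (simp add: a.zero_left)
  qed (auto simp: sq_int_on_const)
  fix yh yv z assume "traj yh yv z"
  from traj_step[OF this, of t v] t
  show "ip z (\<lambda>_. v) + ip (\<lambda>_. 0) yv = inner (yh t) (j v) - inner (yh 0) (j v)"
    by (simp add: indicator_Iv ip_def[of z])
qed

text \<open>The inverse of A applied to v, with v regarded as an element of V* through H.\<close>

definition K :: "'v \<Rightarrow> 'v" where
  "K v = rep (Blinfun (\<lambda>u. inner (j v) (j u)))"

lemma K: "a (K v) u = inner (j v) (j u)"
proof -
  have "bounded_linear (\<lambda>u. inner (j v) (j u))"
    by (rule bounded_linear_compose[OF bounded_linear_inner_right j])
  then show ?thesis by (simp add: K_def rep bounded_linear_Blinfun_apply)
qed

text \<open>With u(s) = (y(s), j v), the first term is the integral of u - u(0) over (0, c) by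
  \<open>ramp_parts\<close>, and the second is minus the integral of u over (0, c) by the choice of
  \<open>K\<close>. Their sum -c u(0) is the boundary term, since the ramp is c at 0 and vanishes at
  t.\<close>

lemma nice_ramp:
  assumes c: "0 \<le> c" "c \<le> t"
  shows "nice (\<lambda>s. ramp c s *\<^sub>R j v) (\<lambda>s. ramp c s *\<^sub>R v) (\<lambda>s. - indicator {..<c} s *\<^sub>R K v)"
  unfolding nice_def
proof (intro conjI allI impI)
  have ind: "sq_int_on t (\<lambda>s. - indicator {..<c} s *\<^sub>R K v)"
    using sq_int_on_indicator[of "{..<c}" t "- K v"] by simp
  show "traj (\<lambda>s. ramp c s *\<^sub>R j v) (\<lambda>s. ramp c s *\<^sub>R v) (\<lambda>s. - indicator {..<c} s *\<^sub>R K v)"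
    unfolding traj_iff
  proof (intro conjI allI impI ind)
    show "sq_int_on t (\<lambda>s. ramp c s *\<^sub>R v)"
      using ramp_bound by (intro sq_int_on_scalar[where K="\<bar>c\<bar>"]) auto
    show "continuous_on {0..t} (\<lambda>s. ramp c s *\<^sub>R j v)"
      by (intro continuous_intros continuous_on_ramp)
    show "AE s in Iv t. j (ramp c s *\<^sub>R v) = ramp c s *\<^sub>R j v" by (simp add: j.scaleR)
    fix \<phi> v' assume \<phi>: "test_fun t \<phi>"
    \<comment> \<open>Here the test function plays the part of u: \<open>ramp_parts\<close> with q =
      \<open>deriv \<phi>\<close> identifies the weak derivative of the ramp.\<close>
    have "(\<integral>s. ramp c s * deriv \<phi> s \<partial>Iv t) = (\<integral>s. indicator {..<c} s * (\<phi> s - \<phi> 0) \<partial>Iv t)"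
      by (rule ramp_parts[OF LINT_deriv_test_fun[OF \<phi>] c])
    also have "\<phi> 0 = 0" using test_fun_outside[OF \<phi>, of 0] by simp
    finally have "(\<integral>s. (ramp c s * deriv \<phi> s) * inner (j v) (j v') \<partial>Iv t)
        = (\<integral>s. (indicator {..<c} s * \<phi> s) * inner (j v) (j v') \<partial>Iv t)"
      by simp
    then show "(\<integral>s. deriv \<phi> s * inner (ramp c s *\<^sub>R j v) (j v') \<partial>Iv t)
        = - (\<integral>s. \<phi> s * a (- indicator {..<c} s *\<^sub>R K v) v' \<partial>Iv t)"
      by (simp add: a.scaleR_left a.minus_left K mult_ac)
  qed
  fix yh yv z assume y: "traj yh yv z"
  define u where "u s = inner (yh s) (j v)" for s
  have cont_u: "continuous_on {0..t} u"
    unfolding u_def by (intro continuous_intros trajD(2)[OF y])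
  have int: "integrable (Iv t) (\<lambda>s. indicator {..<c} s * u s)"
    using integrable_mult_bounded[OF continuous_integrable_Iv[OF cont_u], of "indicator {..<c}" 1]
    by (auto simp: indicator_def)
  have "ip z (\<lambda>s. ramp c s *\<^sub>R v) = (\<integral>s. ramp c s * a (z s) v \<partial>Iv t)"
    by (simp add: ip_def a.scaleR_right)
  also have "\<dots> = (\<integral>s. indicator {..<c} s * (u s - u 0) \<partial>Iv t)"
    by (rule ramp_parts[OF integrable_form_const[OF trajD(4)[OF y]] _ c])
      (simp add: traj_step[OF y] u_def)
  also have "\<dots> = (\<integral>s. indicator {..<c} s * u s - indicator {..<c} s * u 0 \<partial>Iv t)"
    by (simp only: right_diff_distrib)
  also have "\<dots> = (\<integral>s. indicator {..<c} s * u s \<partial>Iv t) - (\<integral>s. indicator {..<c} s * u 0 \<partial>Iv t)"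
    using integrable_mult_bounded[OF integrable_Iv_const[of t "u 0"], of "indicator {..<c}" 1]
    by (intro Bochner_Integration.integral_diff int) (auto simp: indicator_def)
  also have "(\<integral>s. indicator {..<c} s * u 0 \<partial>Iv t) = c * u 0"
    using LINT_Iv_lessThan[OF c] by (simp only: integral_mult_left_zero)
  finally have 1: "ip z (\<lambda>s. ramp c s *\<^sub>R v) = (\<integral>s. indicator {..<c} s * u s \<partial>Iv t) - c * u 0" .
  have "ip (\<lambda>s. - indicator {..<c} s *\<^sub>R K v) yv = (\<integral>s. - (indicator {..<c} s * u s) \<partial>Iv t)"
    unfolding ip_def
  proof (rule integral_cong_AE)
    show "(\<lambda>s. a (- indicator {..<c} s *\<^sub>R K v) (yv s)) \<in> borel_measurable (Iv t)"
      by (intro borel_measurable_integrable integrable_form ind trajD(1)[OF y])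
    show "(\<lambda>s. - (indicator {..<c} s * u s)) \<in> borel_measurable (Iv t)"
      using int by (intro borel_measurable_uminus borel_measurable_integrable)
    show "AE s in Iv t. a (- indicator {..<c} s *\<^sub>R K v) (yv s) = - (indicator {..<c} s * u s)"
      using trajD(3)[OF y]
      by eventually_elim (simp add: a.scaleR_left a.minus_left K u_def inner_commute)
  qed
  then have 2: "ip (\<lambda>s. - indicator {..<c} s *\<^sub>R K v) yv = - (\<integral>s. indicator {..<c} s * u s \<partial>Iv t)"
    by simp
  show "ip z (\<lambda>s. ramp c s *\<^sub>R v) + ip (\<lambda>s. - indicator {..<c} s *\<^sub>R K v) yv
      = inner (yh t) (ramp c t *\<^sub>R j v) - inner (yh 0) (ramp c 0 *\<^sub>R j v)"
    unfolding 1 2 using c by (simp add: ramp_def u_def)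
qed

end

section \<open>Density of the range\<close>

lemma integrable_indicator_mult:
  assumes "A \<in> sets borel" shows "integrable (Iv t) (\<lambda>s. indicator A s * (r :: real))"
  using integrable_mult_bounded[OF integrable_Iv_const[of t r], of "indicator A" 1] assms
  by (auto simp: indicator_def)

context gelfand_form
begin

text \<open>Equal to 1 before c - h and to 0 from c on, linear in between: adding
  \<open>hat c h\<close> times d changes a trajectory by d before the step and not at all after
  it.\<close>

definition hat :: "real \<Rightarrow> real \<Rightarrow> real \<Rightarrow> real" where
  "hat c h s = (ramp c s - ramp (c - h) s) / h"

lemma hat_cases:
  assumes "0 < h"
  shows "c \<le> s \<Longrightarrow> hat c h s = 0" "s < c - h \<Longrightarrow> hat c h s = 1"
    "c - h \<le> s \<Longrightarrow> s < c \<Longrightarrow> 0 \<le> hat c h s \<and> hat c h s \<le> 1"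
  using assms by (auto simp: hat_def ramp_def)

lemma nice_hat:
  assumes "0 < h" "0 \<le> c - h" "c \<le> t"
  shows "nice (\<lambda>s. hat c h s *\<^sub>R j d) (\<lambda>s. hat c h s *\<^sub>R d)
    (\<lambda>s. - (indicator {c - h..<c} s / h) *\<^sub>R K d)"
proof -
  \<comment> \<open>The zero summands come from \<open>nice_const\<close> with v = 0, since
    \<open>nice_lin\<close> produces multiples only as part of a sum.\<close>
  have "nice (\<lambda>s. j 0 + (1 / h) *\<^sub>R (ramp c s *\<^sub>R j d + (- 1) *\<^sub>R (ramp (c - h) s *\<^sub>R j d)))
    (\<lambda>s. 0 + (1 / h) *\<^sub>R (ramp c s *\<^sub>R d + (- 1) *\<^sub>R (ramp (c - h) s *\<^sub>R d)))
    (\<lambda>s. 0 + (1 / h) *\<^sub>R (- indicator {..<c} s *\<^sub>R K d + (- 1) *\<^sub>R (- indicator {..<c - h} s *\<^sub>R K d)))"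
    by (intro nice_lin nice_const nice_ramp) (use assms in auto)
  also have "(\<lambda>s. j 0 + (1 / h) *\<^sub>R (ramp c s *\<^sub>R j d + (- 1) *\<^sub>R (ramp (c - h) s *\<^sub>R j d)))
      = (\<lambda>s. hat c h s *\<^sub>R j d)"
    by (auto simp: hat_def fun_eq_iff j.zero scaleR_diff_left diff_divide_distrib scaleR_diff_right)
  also have "(\<lambda>s. 0 + (1 / h) *\<^sub>R (ramp c s *\<^sub>R d + (- 1) *\<^sub>R (ramp (c - h) s *\<^sub>R d)))
      = (\<lambda>s. hat c h s *\<^sub>R d)"
    by (auto simp: hat_def fun_eq_iff scaleR_diff_left diff_divide_distrib scaleR_diff_right)
  also have "(\<lambda>s. 0 + (1 / h) *\<^sub>R (- indicator {..<c} s *\<^sub>R K d + (- 1) *\<^sub>R (- indicator {..<c - h} s *\<^sub>R K d)))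
      = (\<lambda>s. - (indicator {c - h..<c} s / h) *\<^sub>R K d)"
    using assms(1) by (auto simp: fun_eq_iff indicator_def)
  finally show ?thesis .
qed

text \<open>For the data v on (0, b), the defect y = v - x satisfies dy/ds = A y with y(b) = v.
  Stepping backwards by h from the later value y to the earlier value y' gives y - y' = h A y', to
  which the inverse of A is applied. Solvability is \<open>riesz\<close> for the form (j u, j v) + h
  a(u, v).\<close>

lemma implicit_Euler_step:
  assumes h: "0 < h"
  shows "\<exists>y'. K (y - y') = h *\<^sub>R y' \<and> a (y - y') (y - y') \<le> a y y - a y' y'"
proof -
  obtain B where B: "\<And>u. norm (j u) \<le> norm u * B" using j.bounded by auto
  interpret F: coercive_form "\<lambda>u v. inner (j u) (j v) + h * a u v" "B\<^sup>2 + h * A_max" "h * A_min"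
  proof (rule coercive_form.intro)
    show "linear (\<lambda>u. inner (j u) (j v) + h * a u v)" for v
      by (rule linearI)
        (simp_all add: j.add j.scaleR inner_add_left a.add_left a.scaleR_left algebra_simps)
    show "inner (j u) (j v) + h * a u v = inner (j v) (j u) + h * a v u" for u v
      by (simp add: inner_commute a_sym[of u v])
    show "0 < h * A_min" using h A_min by simp
    show "\<bar>inner (j u) (j v) + h * a u v\<bar> \<le> (B\<^sup>2 + h * A_max) * norm u * norm v" for u v
    proof -
      have "\<bar>inner (j u) (j v)\<bar> \<le> norm (j u) * norm (j v)" by (rule Cauchy_Schwarz_ineq2)
      also have "\<dots> \<le> (norm u * B) * (norm v * B)"
        by (intro mult_mono' B) auto
      finally have 1: "\<bar>inner (j u) (j v)\<bar> \<le> B\<^sup>2 * norm u * norm v"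
        by (simp add: power2_eq_square mult_ac)
      have "\<bar>h * a u v\<bar> \<le> h * (A_max * norm u * norm v)"
        using h a_bdd[of u v] by (simp add: abs_mult)
      with 1 show ?thesis by (simp add: distrib_right mult.assoc)
    qed
    show "h * A_min * (norm v)\<^sup>2 \<le> inner (j v) (j v) + h * a v v" for v
    proof -
      have "h * A_min * (norm v)\<^sup>2 \<le> h * a v v"
        using mult_left_mono[OF a_coer[of v], of h] h by (simp add: mult.assoc)
      also have "\<dots> \<le> inner (j v) (j v) + h * a v v" by simp
      finally show ?thesis .
    qed
  qed
  have "bounded_linear (\<lambda>u. inner (j y) (j u))"
    by (rule bounded_linear_compose[OF bounded_linear_inner_right j])
  from F.riesz[OF this] obtain y' where y': "\<And>v. inner (j y') (j v) + h * a y' v = inner (j y) (j v)"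
    by blast
  have K_eq: "a (K (y - y')) v = h * a y' v" for v
    using y'[of v] by (simp add: K j.diff inner_diff_left)
  have "a (K (y - y') - h *\<^sub>R y') v = 0" for v
    using K_eq[of v] by (simp add: a.diff_left a.scaleR_left)
  then have "K (y - y') = h *\<^sub>R y'" using a_eq_0_iff[of "K (y - y') - h *\<^sub>R y'"] by simp
  \<comment> \<open>Testing the Euler equation with y - y' gives the squared H-norm of y - y' on the
    other side.\<close>
  moreover have "0 \<le> h * a y' (y - y')"
    using K_eq[of "y - y'"] by (simp add: K flip: K_eq)
  then have "0 \<le> a y' (y - y')" using h by (simp add: zero_le_mult_iff)
  then have "a (y - y') (y - y') \<le> a y y - a y' y'"
    by (simp add: a.diff_left a.diff_right a_sym[of y y'])
  ultimately show ?thesis by blast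
qed

text \<open>Piecewise linear interpolation of \<open>n\<close> implicit Euler steps backwards from time \<open>b\<close>. On a
  step with increment \<open>d = y - y'\<close> the residual is a fraction of \<open>d\<close>, and
  \<open>a d d \<le> a y y - a y' y'\<close> telescopes; hence the residual is of order \<open>h\<close>.\<close>

lemma Euler_chain:
  assumes h: "0 < h" and b: "b \<le> t"
  shows "0 \<le> b - real n * h \<Longrightarrow> \<exists>y xh xv w. nice xh xv w \<and> xh t = 0 \<and>
    (\<forall>s. s < b - real n * h \<longrightarrow> xv s - w s = v - y) \<and>
    ip (\<lambda>s. indicator {..<b} s *\<^sub>R v - (xv s - w s)) (\<lambda>s. indicator {..<b} s *\<^sub>R v - (xv s - w s))
      \<le> (b - real n * h) * a y y + h * (a v v - a y y)"
proof (induction n)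
  case 0
  \<comment> \<open>With no step taken, x = 0 and y = v, so the residual is v on all of (0,
    b).\<close>
  have "ip (\<lambda>s. indicator {..<b} s *\<^sub>R v) (\<lambda>s. indicator {..<b} s *\<^sub>R v)
      = (\<integral>s. indicator {..<b} s * a v v \<partial>Iv t)"
    unfolding ip_def by (intro Bochner_Integration.integral_cong refl)
      (auto simp: a.scaleR_left a.scaleR_right indicator_def)
  also have "\<dots> = b * a v v"
    using LINT_Iv_lessThan[of b t] 0 b by (simp only: integral_mult_left_zero)
  finally show ?case
    using nice_const[of 0] by (intro exI[of _ v] exI[of _ "\<lambda>_. j 0"] exI[of _ "\<lambda>_. 0"]) (simp add: j.zero)
next
  case (Suc n)
  define c where "c = b - real n * h"
  have c: "0 \<le> c - h" "c \<le> b" "c - h < c" "0 \<le> c" using Suc.prems h by (auto simp: c_def algebra_simps)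
  have "0 \<le> b - real n * h" using c(4) by (simp add: c_def)
  from Suc.IH[OF this] obtain y xh xv w where x: "nice xh xv w" "xh t = 0"
    and low: "\<And>s. s < c \<Longrightarrow> xv s - w s = v - y"
    and err: "ip (\<lambda>s. indicator {..<b} s *\<^sub>R v - (xv s - w s)) (\<lambda>s. indicator {..<b} s *\<^sub>R v - (xv s - w s))
      \<le> c * a y y + h * (a v v - a y y)"
    unfolding c_def by blast
  obtain y' where y': "K (y - y') = h *\<^sub>R y'" "a (y - y') (y - y') \<le> a y y - a y' y'"
    using implicit_Euler_step[OF h] by blast
  define d where "d = y - y'"
  define xh' where "xh' s = xh s + 1 *\<^sub>R (hat c h s *\<^sub>R j d)" for s
  define xv' where "xv' s = xv s + 1 *\<^sub>R (hat c h s *\<^sub>R d)" for s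
  define w' where "w' s = w s + 1 *\<^sub>R (- (indicator {c - h..<c} s / h) *\<^sub>R K d)" for s
  have nice': "nice xh' xv' w'"
    unfolding xh'_def xv'_def w'_def by (intro nice_lin x(1) nice_hat h) (use c b in auto)
  \<comment> \<open>The Euler equation K d = h y' cancels the factor 1/h from the slope of the hat,
    so the bound does not blow up as h shrinks.\<close>
  have w'_eq: "w' s = w s - indicator {c - h..<c} s *\<^sub>R y'" for s
    using h by (simp add: w'_def d_def y'(1))
  have "xh' t = 0" using x(2) hat_cases(1)[OF h, of c t] c b by (simp add: xh'_def)
  define e where "e s = indicator {..<b} s *\<^sub>R v - (xv s - w s)" for s
  define e' where "e' s = indicator {..<b} s *\<^sub>R v - (xv' s - w' s)" for s
  have sq: "sq_int_on t e" "sq_int_on t e'"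
    using x(1) nice' unfolding e_def e'_def nice_def
    by (auto intro!: sq_int_on_diff sq_int_on_indicator dest: trajD(1,4))
  have low': "xv' s - w' s = v - y'" if "s < c - h" for s
    using low[of s] that c hat_cases(2)[OF h that] unfolding xv'_def w'_eq d_def
    by (simp add: algebra_simps)
  \<comment> \<open>Before c - h the residual changes from y to y'; on [c - h, c) it changes from y
    to the fraction (1 - hat) of d; from c on it is unchanged.\<close>
  have pt: "a (e' s) (e' s) \<le> a (e s) (e s) - indicator {..<c} s * a y y
      + indicator {..<c - h} s * a y' y' + indicator {c - h..<c} s * a d d" for s
  proof -
    consider "s < c - h" | "c - h \<le> s" "s < c" | "c \<le> s" by linarith
    then show ?thesis
    proof cases
      case 1
      then have "e' s = y'" "e s = y" using low[of s] low'[of s] c by (simp_all add: e_def e'_def)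
      then show ?thesis using 1 c by simp
    next
      case 2
      then have "e s = y" using low[of s] c by (simp add: e_def)
      moreover have "e' s = (1 - hat c h s) *\<^sub>R d"
        using low[of s] 2 c unfolding e'_def xv'_def w'_eq by (simp add: d_def algebra_simps)
      moreover have "a ((1 - hat c h s) *\<^sub>R d) ((1 - hat c h s) *\<^sub>R d) \<le> a d d"
        using hat_cases(3)[OF h 2] a_nonneg[of d]
        by (simp add: a.scaleR_left a.scaleR_right mult_left_le_one_le mult_le_one flip: mult.assoc)
      ultimately show ?thesis using 2 c by simp
    next
      case 3
      then have "e' s = e s" using hat_cases(1)[OF h 3] by (simp add: e_def e'_def xv'_def w'_eq)
      then show ?thesis using 3 c by simp
    qed
  qed
  note int = integrable_form[OF sq(1) sq(1)] integrable_indicator_mult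
  have "ip e' e' \<le> (\<integral>s. a (e s) (e s) - indicator {..<c} s * a y y
      + indicator {..<c - h} s * a y' y' + indicator {c - h..<c} s * a d d \<partial>Iv t)"
    unfolding ip_def
    by (intro integral_mono pt integrable_form sq Bochner_Integration.integrable_add
        Bochner_Integration.integrable_diff int) auto
  also have "\<dots> = ip e e - c * a y y + (c - h) * a y' y' + h * a d d"
  proof -
    have 1: "(\<integral>s. indicator {..<c} s * a y y \<partial>Iv t) = c * a y y"
      "(\<integral>s. indicator {..<c - h} s * a y' y' \<partial>Iv t) = (c - h) * a y' y'"
      "(\<integral>s. indicator {c - h..<c} s * a d d \<partial>Iv t) = h * a d d"
      using LINT_Iv_lessThan[of c t] LINT_Iv_lessThan[of "c - h" t] LINT_Iv_interval[of "c - h" c t] c b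
      by (simp_all only: integral_mult_left_zero) auto
    show ?thesis
      unfolding 1[symmetric] ip_def using int by simp
  qed
  also have "\<dots> \<le> (c - h) * a y' y' + h * (a v v - a y' y')"
    using err mult_left_mono[OF y'(2), of h] h unfolding e_def[abs_def, symmetric] d_def
    by (simp add: algebra_simps)
  finally have "ip e' e' \<le> (c - h) * a y' y' + h * (a v v - a y' y')" .
  moreover have "c - h = b - real (Suc n) * h" by (simp add: c_def algebra_simps)
  ultimately show ?case
    using nice' \<open>xh' t = 0\<close> low' unfolding e'_def[abs_def]
    by (intro exI[of _ y'] exI[of _ xh'] exI[of _ xv'] exI[of _ w']) simp
qed

lemma approx_step:
  assumes b: "0 \<le> b" "b \<le> t" and \<epsilon>: "0 < \<epsilon>"
  shows "\<exists>xh xv w. nice xh xv w \<and> xh t = 0 \<and>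
    ip (\<lambda>s. indicator {..<b} s *\<^sub>R v - (xv s - w s)) (\<lambda>s. indicator {..<b} s *\<^sub>R v - (xv s - w s)) \<le> \<epsilon>"
proof (cases "b = 0")
  case True
  have "ip (\<lambda>s. indicator {..<b} s *\<^sub>R v - (0 - 0)) (\<lambda>s. indicator {..<b} s *\<^sub>R v - (0 - 0)) = ip (\<lambda>_. 0) (\<lambda>_. 0)"
    by (rule ip_cong) (auto simp: True)
  then show ?thesis using nice_const[of 0] \<epsilon>
    by (intro exI[of _ "\<lambda>_. j 0"] exI[of _ "\<lambda>_. 0"]) (simp add: j.zero)
next
  case False
  with b have b0: "0 < b" by simp
  \<comment> \<open>After N steps of length b / N no unsolved interval is left and the error is at
    most (b / N) a(v, v).\<close>
  obtain N where N: "b * a v v / \<epsilon> < real N" using reals_Archimedean2 by blast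
  moreover have "0 \<le> b * a v v / \<epsilon>" using b \<epsilon> a_nonneg by simp
  ultimately have N0: "0 < real N" by linarith
  define h where "h = b / real N"
  have h: "0 < h" using b0 N0 by (simp add: h_def)
  have bN: "b - real N * h = 0" using N0 by (simp add: h_def)
  obtain y xh xv w where x: "nice xh xv w" "xh t = 0"
    and err: "ip (\<lambda>s. indicator {..<b} s *\<^sub>R v - (xv s - w s)) (\<lambda>s. indicator {..<b} s *\<^sub>R v - (xv s - w s))
      \<le> h * (a v v - a y y)"
    using Euler_chain[OF h b(2), of N v] unfolding bN by auto
  have "h * (a v v - a y y) \<le> h * a v v" using h a_nonneg[of y] by (intro mult_left_mono) auto
  also have "\<dots> \<le> \<epsilon>" using N N0 \<epsilon> by (simp add: h_def field_simps)
  finally show ?thesis using x err by force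
qed

section \<open>From step functions to all data\<close>

lemma ip_add_le:
  assumes "sq_int_on t p" "sq_int_on t q"
  shows "ip (\<lambda>s. p s + q s) (\<lambda>s. p s + q s) \<le> 2 * ip p p + 2 * ip q q"
  using ip_nonneg[of "\<lambda>s. p s + (-1) *\<^sub>R q s"] ip_scaled_sum[OF assms, of "-1"] ip_scaled_sum[OF assms, of 1]
  by simp

lemma ip_le_norm:
  assumes "sq_int_on t p" shows "ip p p \<le> A_max * (\<integral>s. (norm (p s))\<^sup>2 \<partial>Iv t)"
proof -
  have "ip p p \<le> (\<integral>s. A_max * (norm (p s))\<^sup>2 \<partial>Iv t)"
    unfolding ip_def using assms
    by (intro integral_mono integrable_form a_le) (simp_all add: sq_int_on_iff)
  then show ?thesis by simp
qed

text \<open>Requiring x(t) = 0 decouples the two components of y: the V-valued part is approximated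
  without disturbing the final value.\<close>

lemma range_dense_zero_end:
  assumes f: "sq_int_on t f" and \<epsilon>: "0 < \<epsilon>"
  shows "\<exists>xh xv w. nice xh xv w \<and> xh t = 0 \<and>
    ip (\<lambda>s. f s - (xv s - w s)) (\<lambda>s. f s - (xv s - w s)) \<le> \<epsilon>"
  using f \<epsilon>
proof (induction arbitrary: \<epsilon> rule: sq_int_on_induct)
  case (step b v)
  \<comment> \<open>Only the part of the half-line inside (0, t) matters, so b is clamped to
    [0, t].\<close>
  define b' where "b' = max 0 (min b t)"
  from approx_step[of b' \<epsilon> v] step t obtain xh xv w where x: "nice xh xv w" "xh t = 0"
    "ip (\<lambda>s. indicator {..<b'} s *\<^sub>R v - (xv s - w s)) (\<lambda>s. indicator {..<b'} s *\<^sub>R v - (xv s - w s)) \<le> \<epsilon>"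
    by (auto simp: b'_def)
  moreover have "ip (\<lambda>s. indicator {..<b} s *\<^sub>R v - (xv s - w s)) (\<lambda>s. indicator {..<b} s *\<^sub>R v - (xv s - w s))
      = ip (\<lambda>s. indicator {..<b'} s *\<^sub>R v - (xv s - w s)) (\<lambda>s. indicator {..<b'} s *\<^sub>R v - (xv s - w s))"
    by (rule ip_cong) (auto simp: b'_def indicator_def)
  ultimately show ?case
    by (intro exI[of _ xh] exI[of _ xv] exI[of _ w] conjI) simp_all
next
  case (add f g)
  \<comment> \<open>\<open>ip_add_le\<close> doubles each of the two errors.\<close>
  have "0 < \<epsilon> / 4" using add.prems by simp
  from add.IH(1)[OF this] add.IH(2)[OF this]
  obtain xh xv w yh yv z where x: "nice xh xv w" "xh t = 0"
      "ip (\<lambda>s. f s - (xv s - w s)) (\<lambda>s. f s - (xv s - w s)) \<le> \<epsilon> / 4"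
    and y: "nice yh yv z" "yh t = 0" "ip (\<lambda>s. g s - (yv s - z s)) (\<lambda>s. g s - (yv s - z s)) \<le> \<epsilon> / 4"
    by blast
  have "sq_int_on t (\<lambda>s. f s - (xv s - w s))" "sq_int_on t (\<lambda>s. g s - (yv s - z s))"
    using x(1) y(1) add.hyps unfolding nice_def by (auto intro!: sq_int_on_diff dest: trajD(1,4))
  from ip_add_le[OF this] x(3) y(3)
  have "ip (\<lambda>s. (f s - (xv s - w s)) + (g s - (yv s - z s))) (\<lambda>s. (f s - (xv s - w s)) + (g s - (yv s - z s))) \<le> \<epsilon>"
    by linarith
  then show ?case
    using nice_lin[OF x(1) y(1), of 1] x(2) y(2)
    by (intro exI[of _ "\<lambda>s. xh s + 1 *\<^sub>R yh s"] exI[of _ "\<lambda>s. xv s + 1 *\<^sub>R yv s"]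
        exI[of _ "\<lambda>s. w s + 1 *\<^sub>R z s"]) (simp add: algebra_simps)
next
  case (lim f F)
  have "(\<lambda>n. A_max * (\<integral>s. (norm (F n s - f s))\<^sup>2 \<partial>Iv t)) \<longlonglongrightarrow> A_max * 0"
    by (intro tendsto_intros lim)
  then have "\<forall>\<^sub>F n in sequentially. A_max * (\<integral>s. (norm (F n s - f s))\<^sup>2 \<partial>Iv t) < \<epsilon> / 4"
    using lim.prems by (intro order_tendstoD) auto
  then obtain n where n: "A_max * (\<integral>s. (norm (F n s - f s))\<^sup>2 \<partial>Iv t) < \<epsilon> / 4"
    by (auto simp: eventually_sequentially)
  from lim.IH[of "\<epsilon> / 4" n] lim.prems obtain xh xv w where x: "nice xh xv w" "xh t = 0"
      "ip (\<lambda>s. F n s - (xv s - w s)) (\<lambda>s. F n s - (xv s - w s)) \<le> \<epsilon> / 4" by auto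
  have sq: "sq_int_on t (\<lambda>s. F n s - (xv s - w s))" "sq_int_on t (\<lambda>s. f s - F n s)"
    using x(1) lim.hyps unfolding nice_def by (auto intro!: sq_int_on_diff dest: trajD(1,4))
  have "ip (\<lambda>s. f s - F n s) (\<lambda>s. f s - F n s) \<le> \<epsilon> / 4"
    using ip_le_norm[OF sq(2)] n by (simp add: norm_minus_commute)
  with ip_add_le[OF sq] x(3) have "ip (\<lambda>s. (F n s - (xv s - w s)) + (f s - F n s))
      (\<lambda>s. (F n s - (xv s - w s)) + (f s - F n s)) \<le> \<epsilon>" by linarith
  then show ?case using x(1,2) by (intro exI[of _ xh] exI[of _ xv] exI[of _ w]) (simp add: algebra_simps)
qed

text \<open>By density of V in H, choose v with j v near y2. The constant trajectory v is mapped by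
  S to (v, j v), so it remains to approximate y1 - v with zero final value.\<close>

lemma range_dense:
  assumes y1: "sq_int_on t y1" and \<epsilon>: "0 < \<epsilon>"
  shows "\<exists>xh xv w. nice xh xv w \<and>
    ip (\<lambda>s. y1 s - (xv s - w s)) (\<lambda>s. y1 s - (xv s - w s)) + (norm (y2 - xh t))\<^sup>2 \<le> \<epsilon>"
proof -
  have "y2 \<in> closure (range j)" using j_dense by simp
  then obtain v where "dist (j v) y2 < sqrt (\<epsilon> / 2)"
    unfolding closure_approachable using \<epsilon> by (metis half_gt_zero imageE real_sqrt_gt_0_iff)
  then have "(norm (y2 - j v))\<^sup>2 < (sqrt (\<epsilon> / 2))\<^sup>2"
    by (intro power_strict_mono) (auto simp: dist_norm norm_minus_commute)
  then have v: "(norm (y2 - j v))\<^sup>2 \<le> \<epsilon> / 2" using \<epsilon> by simp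
  obtain xh xv w where x: "nice xh xv w" "xh t = 0"
    "ip (\<lambda>s. (y1 s - v) - (xv s - w s)) (\<lambda>s. (y1 s - v) - (xv s - w s)) \<le> \<epsilon> / 2"
    using range_dense_zero_end[OF sq_int_on_diff[OF y1 sq_int_on_const], of "\<epsilon> / 2" v] \<epsilon> by auto
  have "nice (\<lambda>s. j v + 1 *\<^sub>R xh s) (\<lambda>s. v + 1 *\<^sub>R xv s) (\<lambda>s. 0 + 1 *\<^sub>R w s)"
    by (rule nice_lin[OF nice_const x(1)])
  then show ?thesis using x(2,3) v
    by (intro exI[of _ "\<lambda>s. j v + 1 *\<^sub>R xh s"] exI[of _ "\<lambda>s. v + 1 *\<^sub>R xv s"]
        exI[of _ "\<lambda>s. 0 + 1 *\<^sub>R w s"]) (simp add: algebra_simps)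
qed

end

section \<open>The inf-sup identity\<close>

lemma continuous_AE_zero_Iv:
  fixes f :: "real \<Rightarrow> 'a::real_normed_vector"
  assumes f: "continuous_on {0..t} f" and ae: "AE s in Iv t. f s = 0" and c: "c \<in> {0..t}" and t: "0 < t"
  shows "f c = 0"
proof -
  \<comment> \<open>The window of length 1/n is divided by c in the ratio c : t - c, as [0, t] is;
    hence it lies in [0, t] once 1/n \<le> t, even when c is an endpoint.\<close>
  let ?r = "\<lambda>n. c - c / t * (1 / real n)"
  have "(\<lambda>n. \<integral>s. real n * deriv smooth_step (real n * (s - ?r n)) * norm (f s) \<partial>Iv t) \<longlonglongrightarrow> norm (f c)"
  proof (rule mollify_tendsto[OF continuous_on_norm[OF f] c])
    have "?r \<longlonglongrightarrow> c - c / t * 0" by (intro tendsto_intros lim_1_over_n)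
    then show "?r \<longlonglongrightarrow> c" by simp
    have "\<forall>\<^sub>F n in sequentially. real n > 1 / t"
      using filterlim_real_sequentially by (simp add: filterlim_at_top_dense)
    then show "\<forall>\<^sub>F n in sequentially. 0 \<le> ?r n \<and> ?r n + 1 / real n \<le> t"
    proof eventually_elim
      case (elim n)
      have n: "0 < real n" using elim t by (meson less_trans zero_less_divide_1_iff)
      define x where "x = 1 / real n"
      have x: "0 \<le> x" "x \<le> t" using elim n t by (simp_all add: x_def field_simps)
      have "c / t * x \<le> c / t * t" using x c t by (intro mult_left_mono) auto
      moreover have "(1 - c / t) * x \<le> (1 - c / t) * t"
        using x c t by (intro mult_left_mono) (auto simp: field_simps)
      ultimately show ?case using t unfolding x_def[symmetric] by (simp add: left_diff_distrib)
    qed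
  qed
  moreover have "(\<integral>s. real n * deriv smooth_step (real n * (s - ?r n)) * norm (f s) \<partial>Iv t) = 0" for n
    by (rule integral_eq_zero_AE) (use ae in eventually_elim, simp)
  ultimately have "(\<lambda>n. 0) \<longlonglongrightarrow> norm (f c)" by (simp only:)
  then show ?thesis using LIMSEQ_unique[OF _ tendsto_const, of 0 "norm (f c)"]
    by (simp add: LIMSEQ_const_iff)
qed

context gelfand_form
begin

section \<open>Norms and duality in terms of representers\<close>

definition nrm :: "(real \<Rightarrow> 'v) \<Rightarrow> 'h \<Rightarrow> real" where
  "nrm p h = sqrt (ip p p + (norm h)\<^sup>2)"

definition nrmX :: "(real \<Rightarrow> 'h) \<Rightarrow> (real \<Rightarrow> 'v) \<Rightarrow> (real \<Rightarrow> 'v) \<Rightarrow> real" where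
  "nrmX xh xv w = sqrt (ip xv xv + ip w w + (norm (xh 0))\<^sup>2)"

lemma nrm_nonneg: "0 \<le> nrm p h" and nrm_sq: "(nrm p h)\<^sup>2 = ip p p + (norm h)\<^sup>2"
  by (simp_all add: nrm_def ip_nonneg)

lemma nrmX_nonneg: "0 \<le> nrmX xh xv w"
  by (simp add: nrmX_def ip_nonneg)

lemma nrm_Cauchy_Schwarz:
  assumes "sq_int_on t p" "sq_int_on t p'"
  shows "\<bar>ip p p' + inner h h'\<bar> \<le> nrm p h * nrm p' h'"
  using real_sqrt_le_mono[OF ip_Cauchy_Schwarz[OF assms sq_int_on_const[of 0] sq_int_on_const[of 0], of h h']]
  by (simp add: nrm_def real_sqrt_mult)

lemma nrmX_Cauchy_Schwarz:
  assumes "traj xh xv w" "traj yh yv z"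
  shows "ip xv yv + ip w z + inner (xh 0) (yh 0) \<le> nrmX xh xv w * nrmX yh yv z"
  using real_sqrt_le_mono[OF ip_Cauchy_Schwarz[OF trajD(1)[OF assms(1)] trajD(1)[OF assms(2)]
      trajD(4)[OF assms(1)] trajD(4)[OF assms(2)], of "xh 0" "yh 0"]]
  by (simp add: nrmX_def real_sqrt_mult)

lemma nrm_triangle:
  assumes p: "sq_int_on t p" and q: "sq_int_on t q"
  shows "nrm q k \<le> nrm p h + nrm (\<lambda>s. p s - q s) (h - k)"
proof (rule power2_le_imp_le)
  let ?r = "\<lambda>s. p s - q s"
  have r: "sq_int_on t ?r" using p q by (rule sq_int_on_diff)
  have "ip q q = ip p p - 2 * ip p ?r + ip ?r ?r"
    using p q r by (simp add: ip_diff_left ip_diff_right ip_sym[of q p])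
  moreover have "(norm k)\<^sup>2 = (norm h)\<^sup>2 - 2 * inner h (h - k) + (norm (h - k))\<^sup>2"
    by (simp add: power2_norm_eq_inner inner_diff_left inner_diff_right inner_commute)
  ultimately have "(nrm q k)\<^sup>2 = (nrm p h)\<^sup>2 - 2 * (ip p ?r + inner h (h - k)) + (nrm ?r (h - k))\<^sup>2"
    by (simp add: nrm_sq algebra_simps)
  also have "\<dots> \<le> (nrm p h + nrm ?r (h - k))\<^sup>2"
    using nrm_Cauchy_Schwarz[OF p r, of h "h - k"] by (simp add: power2_sum)
  finally show "(nrm q k)\<^sup>2 \<le> (nrm p h + nrm ?r (h - k))\<^sup>2" .
qed (simp add: nrm_nonneg add_nonneg_nonneg)

text \<open>The cross terms of the expansion are minus the integration by parts expression: they
  cancel the product of the final values and leave that of the initial values.\<close>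

lemma isometry:
  assumes x: "traj xh xv w" and z: "nice zh zv z"
  shows "ip (\<lambda>s. xv s - w s) (\<lambda>s. zv s - z s) + inner (xh t) (zh t)
    = ip xv zv + ip w z + inner (xh 0) (zh 0)"
proof -
  have tz: "traj zh zv z" using z by (simp add: nice_def)
  have "ip w zv + ip z xv = inner (xh t) (zh t) - inner (xh 0) (zh 0)"
    using z x by (simp add: nice_def)
  then show ?thesis
    using trajD(1,4)[OF x] trajD(1,4)[OF tz]
    by (simp add: ip_diff_left ip_diff_right sq_int_on_diff ip_sym[of xv z])
qed

lemma nice_nrmX:
  assumes z: "nice zh zv z" shows "nrmX zh zv z = nrm (\<lambda>s. zv s - z s) (zh t)"
  using isometry[of zh zv z, OF _ z] z by (simp add: nice_def nrmX_def nrm_def power2_norm_eq_inner)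

lemma approx_nrm:
  assumes y1: "sq_int_on t y1" and d: "0 < d"
  obtains zh zv z where "nice zh zv z" "nrm (\<lambda>s. y1 s - (zv s - z s)) (y2 - zh t) \<le> d"
proof -
  from range_dense[OF y1, of "d\<^sup>2" y2] d obtain zh zv z where z: "nice zh zv z"
    "ip (\<lambda>s. y1 s - (zv s - z s)) (\<lambda>s. y1 s - (zv s - z s)) + (norm (y2 - zh t))\<^sup>2 \<le> d\<^sup>2"
    by auto
  from real_sqrt_le_mono[OF z(2)] d have "nrm (\<lambda>s. y1 s - (zv s - z s)) (y2 - zh t) \<le> d"
    by (simp add: nrm_def)
  with z(1) show ?thesis by (rule that)
qed

text \<open>Cauchy-Schwarz in Y^t x H would bring in the norm of S x, which is not yet known to be
  at most |x| for a general x. Replacing y by S z turns the pairing into the X^t inner product of x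
  and z, where Cauchy-Schwarz gives |x| |z| = |x| |S z|.\<close>

lemma pairing_le:
  assumes y1: "sq_int_on t y1" and x: "traj xh xv w"
  shows "ip (\<lambda>s. xv s - w s) y1 + inner (xh t) y2 \<le> nrm y1 y2 * nrmX xh xv w"
proof (rule field_le_epsilon)
  fix e :: real assume e: "0 < e"
  let ?p = "\<lambda>s. xv s - w s"
  have p: "sq_int_on t ?p" using sq_int_on_diff[OF trajD(1,4)[OF x]] .
  \<comment> \<open>The replacement costs d times the sum of |S x| and |x|; the added 1 makes the
    divisor positive.\<close>
  define C where "C = nrm ?p (xh t) + nrmX xh xv w + 1"
  have C: "0 < C" using nrm_nonneg[of ?p "xh t"] nrmX_nonneg[of xh xv w] by (simp add: C_def)
  define d where "d = e / C"
  have d: "0 < d" using e C by (simp add: d_def)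
  obtain zh zv z where z: "nice zh zv z" and close: "nrm (\<lambda>s. y1 s - (zv s - z s)) (y2 - zh t) \<le> d"
    by (rule approx_nrm[OF y1 d])
  let ?q = "\<lambda>s. zv s - z s" and ?r = "\<lambda>s. y1 s - (zv s - z s)"
  have tz: "traj zh zv z" using z by (simp add: nice_def)
  have q: "sq_int_on t ?q" using sq_int_on_diff[OF trajD(1,4)[OF tz]] .
  have r: "sq_int_on t ?r" using sq_int_on_diff[OF y1 q] .
  have "ip ?p y1 + inner (xh t) y2
      = (ip ?p ?r + inner (xh t) (y2 - zh t)) + (ip ?p ?q + inner (xh t) (zh t))"
    using ip_diff_right[OF y1 q p] by (simp add: inner_diff_right)
  also have "\<dots> \<le> nrm ?p (xh t) * d + nrmX xh xv w * (nrm y1 y2 + d)"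
  proof (rule add_mono)
    have "ip ?p ?r + inner (xh t) (y2 - zh t) \<le> nrm ?p (xh t) * nrm ?r (y2 - zh t)"
      using nrm_Cauchy_Schwarz[OF p r, of "xh t" "y2 - zh t"] by simp
    also have "\<dots> \<le> nrm ?p (xh t) * d" by (intro mult_left_mono close nrm_nonneg)
    finally show "ip ?p ?r + inner (xh t) (y2 - zh t) \<le> nrm ?p (xh t) * d" .
    have "ip ?p ?q + inner (xh t) (zh t) \<le> nrmX xh xv w * nrmX zh zv z"
      using isometry[OF x z] nrmX_Cauchy_Schwarz[OF x tz] by simp
    also have "\<dots> \<le> nrmX xh xv w * (nrm y1 y2 + d)"
      using nrm_triangle[OF y1 q, of "zh t" y2] close unfolding nice_nrmX[OF z]
      by (intro mult_left_mono nrmX_nonneg) simp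
    finally show "ip ?p ?q + inner (xh t) (zh t) \<le> nrmX xh xv w * (nrm y1 y2 + d)" .
  qed
  also have "\<dots> \<le> nrm y1 y2 * nrmX xh xv w + d * C"
    using d by (simp add: C_def algebra_simps)
  also have "d * C = e" using C by (simp add: d_def)
  finally show "ip ?p y1 + inner (xh t) y2 \<le> nrm y1 y2 * nrmX xh xv w + e" .
qed

text \<open>Continuity makes x vanish at every time, so by \<open>traj_step\<close> w is orthogonal
  to all step functions and hence to every f. Consequently a trajectory with nonzero pairing is
  admissible in \<open>Xset\<close>.\<close>

lemma traj_zero:
  assumes x: "traj xh xv w" and zero: "AE s in Iv t. xv s = 0" and f: "sq_int_on t f"
  shows "xh t = 0" "ip (\<lambda>s. xv s - w s) f = 0"
proof -
  have "AE s in Iv t. xh s = 0"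
    using trajD(3)[OF x] zero by eventually_elim (simp add: j.zero)
  then have xh: "xh c = 0" if "c \<in> {0..t}" for c
    using continuous_AE_zero_Iv[OF trajD(2)[OF x] _ that t] by blast
  then show "xh t = 0" using t by simp
  have initial: "(\<integral>s. indicator {..<b} s * a (w s) v \<partial>Iv t) = 0" if "0 \<le> b" "b \<le> t" for b v
    using traj_step[OF x that] xh that t by simp
  have sw: "sq_int_on t w" using trajD(4)[OF x] .
  have "ip w f = 0"
    using f
  proof (induction rule: sq_int_on_induct)
    case (step b v)
    have "ip w (\<lambda>s. indicator {..<b} s *\<^sub>R v) = (\<integral>s. indicator {..<max 0 (min b t)} s * a (w s) v \<partial>Iv t)"
      unfolding ip_def by (intro Bochner_Integration.integral_cong refl)
        (auto simp: a.scaleR_right space_restrict_space indicator_def)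
    then show ?case using initial[of "max 0 (min b t)" v] t by simp
  next
    case (add f g)
    then show ?case using ip_lin_right[OF add(1,2) sw, of 1] by simp
  next
    case (lim f F)
    have bound: "(ip w f)\<^sup>2 \<le> ip w w * (A_max * (\<integral>s. (norm (F n s - f s))\<^sup>2 \<partial>Iv t))" for n
    proof -
      have Ff: "sq_int_on t (\<lambda>s. F n s - f s)" using lim.hyps by (intro sq_int_on_diff)
      have "ip w (\<lambda>s. F n s - f s) = - ip w f"
        using ip_diff_right[OF lim.hyps(2) lim.hyps(1) sw, of n] lim.IH[of n] by simp
      then have "(ip w f)\<^sup>2 \<le> ip w w * ip (\<lambda>s. F n s - f s) (\<lambda>s. F n s - f s)"
        using ip_Cauchy_Schwarz[OF sw Ff sq_int_on_const[of 0] sq_int_on_const[of 0], of 0 0] by simp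
      also have "\<dots> \<le> ip w w * (A_max * (\<integral>s. (norm (F n s - f s))\<^sup>2 \<partial>Iv t))"
        by (intro mult_left_mono ip_le_norm Ff ip_nonneg)
      finally show ?thesis .
    qed
    have "(\<lambda>n. ip w w * (A_max * (\<integral>s. (norm (F n s - f s))\<^sup>2 \<partial>Iv t))) \<longlonglongrightarrow> ip w w * (A_max * 0)"
      by (intro tendsto_intros lim)
    then have "(ip w f)\<^sup>2 \<le> ip w w * (A_max * 0)"
      by (rule LIMSEQ_le_const) (use bound in blast)
    then show ?case by simp
  qed
  moreover have "ip xv f = 0"
    unfolding ip_def by (rule integral_eq_zero_AE) (use zero in eventually_elim, simp add: a.zero_left)
  ultimately show "ip (\<lambda>s. xv s - w s) f = 0"
    using ip_diff_left[OF trajD(1)[OF x] sw f] by simp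
qed

text \<open>Take z with S z within d of y. With N = |y|, the pairing is at least N (N - d), while
  |z| = |S z| \<le> N + d.\<close>

lemma pairing_near_attained:
  assumes y1: "sq_int_on t y1" and pos: "0 < nrm y1 y2" and r: "r < 1"
  shows "\<exists>xh xv w. traj xh xv w \<and> \<not> (AE s in Iv t. xv s = 0) \<and>
    r < (ip (\<lambda>s. xv s - w s) y1 + inner (xh t) y2) / (nrm y1 y2 * nrmX xh xv w)"
proof -
  define N where "N = nrm y1 y2"
  \<comment> \<open>A nonnegative bound is needed to multiply inequalities by it.\<close>
  define r' where "r' = max 0 r"
  have r': "0 \<le> r'" "r' < 1" "r \<le> r'" using r by (auto simp: r'_def)
  \<comment> \<open>This makes 3 d = N (1 - r'), so (1 + r') d < N (1 - r'), which is r' (N + d) < N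
    - d.\<close>
  define d where "d = N * (1 - r') / 3"
  have d: "0 < d" using pos r' by (simp add: d_def N_def)
  obtain zh zv z where z: "nice zh zv z" and close: "nrm (\<lambda>s. y1 s - (zv s - z s)) (y2 - zh t) \<le> d"
    by (rule approx_nrm[OF y1 d])
  let ?q = "\<lambda>s. zv s - z s" and ?r = "\<lambda>s. y1 s - (zv s - z s)"
  have tz: "traj zh zv z" using z by (simp add: nice_def)
  have q: "sq_int_on t ?q" using sq_int_on_diff[OF trajD(1,4)[OF tz]] .
  have sr: "sq_int_on t ?r" using sq_int_on_diff[OF y1 q] .
  define B where "B = ip ?q y1 + inner (zh t) y2"
  have "B = N\<^sup>2 - (ip ?r y1 + inner (y2 - zh t) y2)"
    using ip_diff_left[OF y1 q y1] by (simp add: B_def N_def nrm_sq inner_diff_left power2_norm_eq_inner)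
  moreover have "ip ?r y1 + inner (y2 - zh t) y2 \<le> d * N"
    using nrm_Cauchy_Schwarz[OF sr y1, of "y2 - zh t" y2] mult_right_mono[OF close nrm_nonneg[of y1 y2]]
    by (simp add: N_def)
  ultimately have B: "N * (N - d) \<le> B" by (simp add: power2_eq_square algebra_simps)
  have N: "0 < N" using pos by (simp add: N_def)
  have dN: "r' * (N + d) < N - d"
  proof -
    have "(1 + r') * d < 2 * d + 0" using d r' by (simp add: algebra_simps)
    also have "\<dots> < N * (1 - r')" using N r' by (simp add: d_def)
    finally show ?thesis by (simp add: algebra_simps)
  qed
  have "0 \<le> r' * (N + d)" using r' N d by simp
  then have "0 < N - d" using dN by linarith
  then have B0: "0 < B" using B N by (meson mult_pos_pos less_le_trans)
  \<comment> \<open>The upper bound is used here to see that |z| is positive, so that the quotient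
    is a genuine one.\<close>
  have up: "B \<le> N * nrmX zh zv z" unfolding B_def N_def by (rule pairing_le[OF y1 tz])
  with B0 N have X0: "0 < nrmX zh zv z" by (meson less_le_trans zero_less_mult_pos)
  have XN: "nrmX zh zv z \<le> N + d"
    using nrm_triangle[OF y1 q, of "zh t" y2] close unfolding nice_nrmX[OF z] N_def by simp
  have "r * (N * nrmX zh zv z) \<le> r' * (N * nrmX zh zv z)"
    using r' N X0 by (intro mult_right_mono) auto
  also have "\<dots> \<le> r' * (N * (N + d))"
    using r' N XN by (intro mult_left_mono) auto
  also have "\<dots> < N * (N - d)" using mult_strict_left_mono[OF dN N] by (simp add: mult_ac)
  finally have "r * (N * nrmX zh zv z) < B" using B by linarith
  then have "r < B / (N * nrmX zh zv z)" using N X0 by (simp add: pos_less_divide_eq)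
  moreover have "\<not> (AE s in Iv t. zv s = 0)"
    using traj_zero[OF tz _ y1] B0 by (auto simp: B_def)
  ultimately show ?thesis using tz unfolding B_def N_def by blast
qed

section \<open>Translation to the form and the norms of the statement\<close>

lemma Bstar_eq:
  "Bstar a t y1 y2 xh xv g = ip (\<lambda>s. xv s - rep (g s)) y1 + inner (xh t) y2"
  unfolding Bstar_def LINT_Iv ip_def by (simp add: a.diff_left rep inner_commute)

lemma normX_eq:
  assumes "traj xh xv (\<lambda>s. rep (g s))"
  shows "normX a t xh xv g = nrmX xh xv (\<lambda>s. rep (g s))"
  using integrable_form[OF trajD(1)[OF assms] trajD(1)[OF assms]]
    integrable_form[OF trajD(4)[OF assms] trajD(4)[OF assms]]
  unfolding normX_def LINT_Iv nrmX_def ip_def Ainvhalf_norm_rep[OF V_nontriv]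
  by (simp add: add.commute)

lemma normY_eq: "normY a t y1 y2 = nrm y1 y2"
  unfolding normY_def LINT_Iv nrm_def ip_def by (simp add: add.commute)

lemma nrm_pos:
  assumes "(y1, y2) \<in> Yset t" shows "0 < nrm y1 y2"
proof (rule ccontr)
  have y1: "sq_int_on t y1" using assms by (simp add: Yset_def)
  assume "\<not> 0 < nrm y1 y2"
  then have "ip y1 y1 + (norm y2)\<^sup>2 = 0" using nrm_nonneg[of y1 y2] nrm_sq[of y1 y2] by simp
  then have "ip y1 y1 = 0" "y2 = 0" using ip_nonneg[of y1] by (simp_all add: add_nonneg_eq_0_iff)
  moreover from this(1) have "AE s in Iv t. a (y1 s) (y1 s) = 0"
    using integral_nonneg_eq_0_iff_AE[OF integrable_form[OF y1 y1]] by (simp add: ip_def a_nonneg)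
  ultimately show False using assms by (simp add: Yset_def a_eq_0_iff AE_restrict_space_iff)
qed

text \<open>Over an empty set the outer supremum and infimum of the constant 1 would be minus and
  plus infinity.\<close>

lemma Yset_nonempty: "Yset t \<noteq> ({} :: ((real \<Rightarrow> 'v) \<times> 'h) set)"
proof -
  obtain v :: 'v where v: "v \<noteq> 0" using V_nontriv by blast
  have "\<not> (AE s in lborel. s \<in> {0<..<t} \<longrightarrow> v = 0)"
  proof
    assume "AE s in lborel. s \<in> {0<..<t} \<longrightarrow> v = 0"
    then have "AE s in Iv t. v = 0" by (subst AE_restrict_space_iff) simp_all
    from continuous_AE_zero_Iv[OF continuous_on_const this, of 0] t v show False by simp
  qed
  then have "(\<lambda>_. v, 0) \<in> (Yset t :: ((real \<Rightarrow> 'v) \<times> 'h) set)"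
    unfolding Yset_def by (intro CollectI case_prodI conjI sq_int_on_const) blast
  then show ?thesis by blast
qed

lemma SUP_ratio:
  assumes y: "y \<in> Yset t"
  shows "(SUP x\<in>Xset j t. ereal (Bstar a t (fst y) (snd y) (fst x) (fst (snd x)) (snd (snd x))
    / (normY a t (fst y) (snd y) * normX a t (fst x) (fst (snd x)) (snd (snd x))))) = 1"
    (is "(SUP x\<in>_. ereal (?ratio x)) = 1")
proof (rule antisym)
  obtain y1 y2 where y_eq: "y = (y1, y2)" by (cases y)
  have y1: "sq_int_on t y1" using y by (simp add: y_eq Yset_def)
  have pos: "0 < nrm y1 y2" using nrm_pos y unfolding y_eq .
  have ratio: "?ratio (xh, xv, g) = (ip (\<lambda>s. xv s - rep (g s)) y1 + inner (xh t) y2)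
      / (nrm y1 y2 * nrmX xh xv (\<lambda>s. rep (g s)))" if "traj xh xv (\<lambda>s. rep (g s))" for xh xv g
    using normX_eq[OF that] by (simp add: y_eq Bstar_eq normY_eq)
  show "(SUP x\<in>Xset j t. ereal (?ratio x)) \<le> 1"
  proof (rule SUP_least)
    fix x assume "x \<in> Xset j t"
    then obtain xh xv g where x: "x = (xh, xv, g)" "traj xh xv (\<lambda>s. rep (g s))"
      by (auto simp: Xset_def traj_rep)
    \<comment> \<open>A zero denominator does no harm to this bound, since the quotient would then
      be 0.\<close>
    have "?ratio x \<le> 1"
      unfolding x(1) ratio[OF x(2)]
      using pairing_le[OF y1 x(2), of y2] nrm_nonneg[of y1 y2] nrmX_nonneg[of xh xv "\<lambda>s. rep (g s)"]
      by (intro divide_le_eq_1[THEN iffD2]) (auto simp: less_le)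
    then show "ereal (?ratio x) \<le> 1" by simp
  qed
  show "1 \<le> (SUP x\<in>Xset j t. ereal (?ratio x))"
    unfolding le_SUP_iff
  proof (intro allI impI)
    fix e :: ereal assume e: "e < 1"
    \<comment> \<open>For e equal to minus infinity any real below 1 serves, here 0.\<close>
    then obtain r where r: "e \<le> ereal r" "r < 1"
      by (cases e) (auto intro: that[of 0])
    obtain xh xv w where x: "traj xh xv w" "\<not> (AE s in Iv t. xv s = 0)"
      "r < (ip (\<lambda>s. xv s - w s) y1 + inner (xh t) y2) / (nrm y1 y2 * nrmX xh xv w)"
      using pairing_near_attained[OF y1 pos r(2)] by blast
    have "(xh, xv, \<lambda>s. emb (w s)) \<in> Xset j t"
      using x(1,2) by (simp add: Xset_def traj_def AE_restrict_space_iff)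
    moreover have "e < ereal (?ratio (xh, xv, \<lambda>s. emb (w s)))"
    proof -
      have "r < ?ratio (xh, xv, \<lambda>s. emb (w s))" using ratio[of xh xv "\<lambda>s. emb (w s)"] x(1,3) by simp
      then show ?thesis using r(1) by (meson ereal_less_ereal_Ex le_less_trans less_ereal.simps(1))
    qed
    ultimately show "\<exists>x\<in>Xset j t. e < ereal (?ratio x)" by blast
  qed
qed

end

theorem theorem2p3:
  fixes j :: "'v::{real_inner,complete_space,second_countable_topology}
                \<Rightarrow> 'h::{real_inner,complete_space,second_countable_topology}"
    and a :: "'v \<Rightarrow> 'v \<Rightarrow> real"
    and A_max A_min T t :: real
  assumes j_lin: "bounded_linear j" and j_inj: "inj j" and j_dense: "closure (range j) = UNIV"
    and V_nontriv: "\<exists>v::'v. v \<noteq> 0"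
    and a_lin: "\<forall>v. linear (\<lambda>u. a u v)"
    and a_sym: "\<forall>u v. a u v = a v u"
    and A_pos: "A_max > 0" "A_min > 0"
    and a_bdd: "\<forall>u v. \<bar>a u v\<bar> \<le> A_max * norm u * norm v"
    and a_coer: "\<forall>v. a v v \<ge> A_min * (norm v)\<^sup>2"
    and t: "0 < t" "t \<le> T"
  shows "(SUP y\<in>Yset t. SUP x\<in>Xset j t.
            ereal (Bstar a t (fst y) (snd y) (fst x) (fst (snd x)) (snd (snd x))
                   / (normY a t (fst y) (snd y) * normX a t (fst x) (fst (snd x)) (snd (snd x))))) = 1
       \<and> (INF y\<in>Yset t. SUP x\<in>Xset j t.
            ereal (Bstar a t (fst y) (snd y) (fst x) (fst (snd x)) (snd (snd x))
                   / (normY a t (fst y) (snd y) * normX a t (fst x) (fst (snd x)) (snd (snd x))))) = 1"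
proof -
  have "coercive_form a A_max A_min"
    using a_lin a_sym A_pos a_bdd a_coer by (intro coercive_form.intro) blast+
  then interpret gelfand_form a A_max A_min j t
    using j_lin j_dense V_nontriv t by (simp add: gelfand_form_def gelfand_form_axioms_def)
  show ?thesis
    using Yset_nonempty by (simp add: SUP_ratio cong: SUP_cong_simp INF_cong_simp)
qed

end
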